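(* For every counter-free visible $\mathrm{HTA}_\pm$ $\mathcal{A}=\langle Q,\Sigma,\delta,q_I,F\rangle$ over $\Sigma=2^{AP}$ there is a $\mathrm{CTL}^*_\pm$ formula $\varphi_{\mathcal{A}}$ such that $\mathcal{L}(\mathcal{A})=\mathcal{L}(\varphi_{\mathcal{A}})$.
   Context: Fix a finite set $AP$, $\Sigma=2^{AP}$; $\Sigma$-trees are unranked (finitely many children per node), unordered, leafless (every node has a child) trees labelled by $\Sigma$. $\mathrm{CTL}^*_\pm$: state formulae $\varphi ::= p\mid\neg\varphi\mid\varphi\lor\varphi\mid\mathsf{D}^n\varphi\mid\mathsf{E}\psi$, path formulae $\psi ::= \varphi\mid\psi\land\psi\mid\psi\lor\psi\mid\mathsf{X}\psi\mid\psi\,\mathsf{U}\,\psi$. At node $u$: $p$ iff $p\in t(u)$; Booleans usual; $\mathsf{D}^n\varphi$ iff $u$ has at least $n$ distinct children satisfying $\varphi$; $\mathsf{E}\psi$ iff there is an infinite path $\pi$ from the root with $\pi(i)=u$ and $(t,\pi,i)\models\psi$, where path formulae use standard infinite-path semantics of $\mathsf{X},\mathsf{U}$ and state formulae are evaluated at the current node. $\mathcal{L}(\varphi)$: trees whose root satisfies $\varphi$. $\mathrm{HTA}_\pm$: $\mathcal{A}=\langle Q,\Sigma,\delta,q_I,F\rangle$, $\delta:Q\times\Sigma\to\mathcal{B}^+(\{\Diamond_k,\Box_k\}_{k\in\mathbb{N}}\times Q)$ (positive Boolean formulae over atoms, with $\top,\bot,\land,\lor$; $\Diamond=\Diamond_1$,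 $\Box=\Box_1$). Run on $t$ from $s$: tree $r$ labelled in $Q\times\mathrm{Dom}(t)$, root $(q_I,s)$, each node $x$ labelled $(q,v)$ satisfies $\delta(q,t(v))$, where $x\models(\Diamond_k,q')$ iff $x$ has children labelled $(q',v_i)$ for $k$ pairwise distinct children $v_i$ of $v$, and $x\models(\Box_k,q')$ iff for all but at most $k-1$ children $v'$ of $v$ some child of $x$ is labelled $(q',v')$. Accepting: every infinite path of $r$ from its root visits $F$ infinitely often. $\mathcal{L}(\mathcal{A})$: trees with an accepting run from the root. For $\theta$ a positive Boolean formula over atoms, $\mathcal{A}^\theta$ is $\mathcal{A}$ with a fresh initial state $q'$ with $\delta(q',\sigma)=\theta$ for all $\sigma$. Hesitant: $Q$ partitioned into nonempty components, totally ordered so that transitions from states of $Q_i$ mention only states of components $Q_j$, $j\le i$; each component is transient (no $Q_i$-atom in $\delta(q,\sigma)$ for $q\in Q_i$), existential ($Q_i$-atoms in such $\delta(q,\sigma)$ only of form $(\Diamond,q')$, at most one per clause of the DNF) or universal (only $(\Box,q')$, at most one per clause of the CNF). Polarised: existential-component states $\notin F$, universal-component states $\in F$. Linearisation: for a non-transient component $Q_i$ and $q\in Q_i$, let $B$ be the set of atoms whose state lies outside $Q_i$; $\mathcal{A}^q_{\mathrm{exit}}$ is the $\omega$-word automaton with states $Q_i\cup\{q_{\mathrm{exit}}\}$ ($q_{\mathrm{exit}}$ fresh), alphabet $\Sigma\times 2^B$, initial state $q$, and transitions $(q',(\sigma,C),q'')$: if $Q_i$ is existential, either $q'=q''=q_{\mathrm{exit}}$,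 or $q'\in Q_i$, $q''=q_{\mathrm{exit}}$ and the DNF of $\delta(q',\sigma)$ contains a clause $\bigwedge C$, or $q',q''\in Q_i$ and the DNF of $\delta(q',\sigma)$ contains a clause $(\Diamond,q'')\land\bigwedge C$; if $Q_i$ is universal, the same with CNF, clauses $\bigvee C$ and $(\Box,q'')\lor\bigvee C$. A word automaton is counter-free if for every state $p$, finite word $u$ and $n>0$, a path on $u^n$ from $p$ to $p$ implies a path on $u$ from $p$ to $p$. $\mathcal{A}$ is counter-free if all linearisations $\mathcal{A}^q_{\mathrm{exit}}$ (for $q$ in non-transient components) are counter-free. $Q_i$ is visible if for all $q\in Q_i$ and every pair of distinct annotations $C\ne C'$ occurring in transitions of $\mathcal{A}^q_{\mathrm{exit}}$ whose source state lies in $Q_i$, there are atoms $\theta\in C$ and $\theta'\in C'$ such that $\mathcal{L}(\mathcal{A}^\theta)$ and $\mathcal{L}(\mathcal{A}^{\theta'})$ are complements of each other; $\mathcal{A}$ is visible if all its non-transient components are visible. *)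

theory Defs
  imports Main
begin

text \<open>A tree is a pair (Dom, t): Dom is a prefix-closed set of addresses (nat lists)
  containing the root [], and t labels nodes by subsets of AP.  Children are unordered
  in the sense that no notion below depends on the order of addresses.\<close>

type_synonym 'ap tree = "nat list set \<times> (nat list \<Rightarrow> 'ap set)"

definition children :: "nat list set \<Rightarrow> nat list \<Rightarrow> nat list set" where
  "children D u = {v \<in> D. \<exists>i. v = u @ [i]}"

definition prefix_closed :: "nat list set \<Rightarrow> bool" where
  "prefix_closed D \<longleftrightarrow> (\<forall>u i. u @ [i] \<in> D \<longrightarrow> u \<in> D)"

definition wf_tree :: "'ap tree \<Rightarrow> bool" where
  "wf_tree t \<longleftrightarrow> [] \<in> fst t \<and> prefix_closed (fst t) \<and>
     (\<forall>u \<in> fst t. finite (children (fst t) u) \<and> children (fst t) u \<noteq> {})"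

datatype 'ap sform = SProp 'ap | SNot "'ap sform" | SOr "'ap sform" "'ap sform"
  | SD nat "'ap sform" | SE "'ap pform"
and 'ap pform = PSt "'ap sform" | PAnd "'ap pform" "'ap pform" | POr "'ap pform" "'ap pform"
  | PX "'ap pform" | PU "'ap pform" "'ap pform"

definition is_tpath :: "'ap tree \<Rightarrow> (nat \<Rightarrow> nat list) \<Rightarrow> bool" where
  "is_tpath t \<pi> \<longleftrightarrow> \<pi> 0 = [] \<and> (\<forall>i. \<pi> (Suc i) \<in> children (fst t) (\<pi> i))"

primrec holds_s :: "'ap tree \<Rightarrow> nat list \<Rightarrow> 'ap sform \<Rightarrow> bool"
  and holds_p :: "'ap tree \<Rightarrow> (nat \<Rightarrow> nat list) \<Rightarrow> nat \<Rightarrow> 'ap pform \<Rightarrow> bool" where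
  "holds_s t u (SProp p) = (p \<in> snd t u)"
| "holds_s t u (SNot \<phi>) = (\<not> holds_s t u \<phi>)"
| "holds_s t u (SOr \<phi> \<psi>) = (holds_s t u \<phi> \<or> holds_s t u \<psi>)"
| "holds_s t u (SD n \<phi>) = (\<exists>S. S \<subseteq> children (fst t) u \<and> finite S \<and> card S = n \<and>
                               (\<forall>v\<in>S. holds_s t v \<phi>))"
| "holds_s t u (SE \<psi>) = (\<exists>\<pi> i. is_tpath t \<pi> \<and> \<pi> i = u \<and> holds_p t \<pi> i \<psi>)"
| "holds_p t \<pi> i (PSt \<phi>) = holds_s t (\<pi> i) \<phi>"
| "holds_p t \<pi> i (PAnd \<psi>1 \<psi>2) = (holds_p t \<pi> i \<psi>1 \<and> holds_p t \<pi> i \<psi>2)"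
| "holds_p t \<pi> i (POr \<psi>1 \<psi>2) = (holds_p t \<pi> i \<psi>1 \<or> holds_p t \<pi> i \<psi>2)"
| "holds_p t \<pi> i (PX \<psi>) = holds_p t \<pi> (Suc i) \<psi>"
| "holds_p t \<pi> i (PU \<psi>1 \<psi>2) = (\<exists>k\<ge>i. holds_p t \<pi> k \<psi>2 \<and>
                                   (\<forall>j. i \<le> j \<and> j < k \<longrightarrow> holds_p t \<pi> j \<psi>1))"

definition ctl_lang :: "'ap sform \<Rightarrow> 'ap tree set" where
  "ctl_lang \<phi> = {t. wf_tree t \<and> holds_s t [] \<phi>}"

datatype 'x pbf = BTrue | BFalse | BAtom 'x | BAnd "'x pbf" "'x pbf" | BOr "'x pbf" "'x pbf"

primrec sat_pbf :: "('x \<Rightarrow> bool) \<Rightarrow> 'x pbf \<Rightarrow> bool" where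
  "sat_pbf f BTrue = True"
| "sat_pbf f BFalse = False"
| "sat_pbf f (BAtom a) = f a"
| "sat_pbf f (BAnd a b) = (sat_pbf f a \<and> sat_pbf f b)"
| "sat_pbf f (BOr a b) = (sat_pbf f a \<or> sat_pbf f b)"

primrec dnf :: "'x pbf \<Rightarrow> 'x set set" where
  "dnf BTrue = {{}}"
| "dnf BFalse = {}"
| "dnf (BAtom a) = {{a}}"
| "dnf (BAnd a b) = {c \<union> d | c d. c \<in> dnf a \<and> d \<in> dnf b}"
| "dnf (BOr a b) = dnf a \<union> dnf b"

primrec cnf :: "'x pbf \<Rightarrow> 'x set set" where
  "cnf BTrue = {}"
| "cnf BFalse = {{}}"
| "cnf (BAtom a) = {{a}}"
| "cnf (BAnd a b) = cnf a \<union> cnf b"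
| "cnf (BOr a b) = {c \<union> d | c d. c \<in> cnf a \<and> d \<in> cnf b}"

datatype modality = Dia nat | Box nat

type_synonym 'q atom = "modality \<times> 'q"

record ('ap, 'q) hta =
  states :: "'q set"
  delta :: "'q \<Rightarrow> 'ap set \<Rightarrow> 'q atom pbf"
  init :: 'q
  acc :: "'q set"

definition hta_wf :: "('ap, 'q) hta \<Rightarrow> bool" where
  "hta_wf A \<longleftrightarrow> finite (states A) \<and> init A \<in> states A \<and> acc A \<subseteq> states A"

fun sat_atom :: "'ap tree \<Rightarrow> nat list set \<Rightarrow> (nat list \<Rightarrow> 'q \<times> nat list) \<Rightarrow> nat list
                   \<Rightarrow> 'q atom \<Rightarrow> bool" where
  "sat_atom t Dr r x (Dia k, q') =
     (\<exists>S. S \<subseteq> children (fst t) (snd (r x)) \<and> finite S \<and> card S = k \<and>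
          (\<forall>v\<in>S. \<exists>y\<in>children Dr x. r y = (q', v)))"
| "sat_atom t Dr r x (Box k, q') =
     (\<exists>S. S \<subseteq> children (fst t) (snd (r x)) \<and> finite S \<and> card S < k \<and>
          (\<forall>v\<in>children (fst t) (snd (r x)) - S. \<exists>y\<in>children Dr x. r y = (q', v)))"

definition is_run :: "('ap, 'q) hta \<Rightarrow> 'ap tree \<Rightarrow> nat list \<Rightarrow> nat list set
                       \<Rightarrow> (nat list \<Rightarrow> 'q \<times> nat list) \<Rightarrow> bool" where
  "is_run A t s Dr r \<longleftrightarrow> [] \<in> Dr \<and> prefix_closed Dr \<and> r [] = (init A, s) \<and>
     (\<forall>x\<in>Dr. fst (r x) \<in> states A \<and> snd (r x) \<in> fst t \<and>
        sat_pbf (sat_atom t Dr r x) (delta A (fst (r x)) (snd t (snd (r x)))))"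

definition accepting :: "('ap, 'q) hta \<Rightarrow> nat list set \<Rightarrow> (nat list \<Rightarrow> 'q \<times> nat list) \<Rightarrow> bool" where
  "accepting A Dr r \<longleftrightarrow> (\<forall>\<rho>. \<rho> 0 = [] \<and> (\<forall>i. \<rho> (Suc i) \<in> children Dr (\<rho> i)) \<longrightarrow>
                              (\<exists>\<^sub>\<infinity>i. fst (r (\<rho> i)) \<in> acc A))"

definition hta_lang :: "('ap, 'q) hta \<Rightarrow> 'ap tree set" where
  "hta_lang A = {t. wf_tree t \<and> (\<exists>Dr r. is_run A t [] Dr r \<and> accepting A Dr r)}"

definition theta_aut :: "('ap, 'q) hta \<Rightarrow> 'q atom \<Rightarrow> ('ap, 'q option) hta" where
  "theta_aut A \<theta> = \<lparr> states = insert None (Some ` states A),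
     delta = (\<lambda>p \<sigma>. case p of None \<Rightarrow> BAtom (fst \<theta>, Some (snd \<theta>))
                            | Some q \<Rightarrow> map_pbf (\<lambda>(m, q'). (m, Some q')) (delta A q \<sigma>)),
     init = None, acc = Some ` acc A \<rparr>"

datatype ckind = Transient | Existential | Universal

fun kind_ok :: "('ap, 'q) hta \<Rightarrow> 'q set \<times> ckind \<Rightarrow> bool" where
  "kind_ok A (Qi, Transient) =
     (\<forall>q\<in>Qi. \<forall>\<sigma>. \<forall>a\<in>set_pbf (delta A q \<sigma>). snd a \<notin> Qi)"
| "kind_ok A (Qi, Existential) =
     (\<forall>q\<in>Qi. \<forall>\<sigma>. \<forall>c\<in>dnf (delta A q \<sigma>).
        (\<forall>a\<in>c. snd a \<in> Qi \<longrightarrow> fst a = Dia 1) \<and> card {a\<in>c. snd a \<in> Qi} \<le> 1)"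
| "kind_ok A (Qi, Universal) =
     (\<forall>q\<in>Qi. \<forall>\<sigma>. \<forall>c\<in>cnf (delta A q \<sigma>).
        (\<forall>a\<in>c. snd a \<in> Qi \<longrightarrow> fst a = Box 1) \<and> card {a\<in>c. snd a \<in> Qi} \<le> 1)"

text \<open>comps: the components Q_1,...,Q_m in their total order (list order), each with its kind.\<close>
definition hesitant :: "('ap, 'q) hta \<Rightarrow> ('q set \<times> ckind) list \<Rightarrow> bool" where
  "hesitant A comps \<longleftrightarrow>
     (\<forall>i<length comps. fst (comps ! i) \<noteq> {}) \<and>
     (\<forall>i<length comps. \<forall>j<length comps. i \<noteq> j \<longrightarrow> fst (comps ! i) \<inter> fst (comps ! j) = {}) \<and>
     \<Union> (fst ` set comps) = states A \<and>
     (\<forall>i<length comps. \<forall>q\<in>fst (comps ! i). \<forall>\<sigma>. \<forall>a\<in>set_pbf (delta A q \<sigma>).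
         \<exists>j\<le>i. snd a \<in> fst (comps ! j)) \<and>
     (\<forall>i<length comps. kind_ok A (comps ! i))"

definition polarised :: "('ap, 'q) hta \<Rightarrow> ('q set \<times> ckind) list \<Rightarrow> bool" where
  "polarised A comps \<longleftrightarrow> (\<forall>(Qi, k)\<in>set comps.
     (k = Existential \<longrightarrow> Qi \<inter> acc A = {}) \<and> (k = Universal \<longrightarrow> Qi \<subseteq> acc A))"

text \<open>Transitions of the linearisation A^q_exit of component Qi (state None = q_exit).
  The transition relation does not depend on the initial state q.\<close>
definition lin_trans :: "('ap, 'q) hta \<Rightarrow> 'q set \<Rightarrow> ckind \<Rightarrow> 'q option
                          \<Rightarrow> 'ap set \<times> 'q atom set \<Rightarrow> 'q option \<Rightarrow> bool" where
  "lin_trans A Qi k p a p'' \<longleftrightarrow> (let \<sigma> = fst a; C = snd a;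
      B = {\<theta> :: 'q atom. snd \<theta> \<notin> Qi};
      cls = (if k = Existential then dnf else cnf);
      md = (if k = Existential then Dia 1 else Box 1) in
    k \<noteq> Transient \<and> C \<subseteq> B \<and>
    ((p = None \<and> p'' = None) \<or>
     (\<exists>q'\<in>Qi. p = Some q' \<and> p'' = None \<and> C \<in> cls (delta A q' \<sigma>)) \<or>
     (\<exists>q'\<in>Qi. \<exists>q''\<in>Qi. p = Some q' \<and> p'' = Some q'' \<and> insert (md, q'') C \<in> cls (delta A q' \<sigma>))))"

fun lin_path :: "('ap, 'q) hta \<Rightarrow> 'q set \<Rightarrow> ckind \<Rightarrow> 'q option
                  \<Rightarrow> ('ap set \<times> 'q atom set) list \<Rightarrow> 'q option \<Rightarrow> bool" where
  "lin_path A Qi k p [] p' = (p = p')"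
| "lin_path A Qi k p (a # w) p' = (\<exists>p''. lin_trans A Qi k p a p'' \<and> lin_path A Qi k p'' w p')"

definition counter_free_lin :: "('ap, 'q) hta \<Rightarrow> 'q set \<Rightarrow> ckind \<Rightarrow> bool" where
  "counter_free_lin A Qi k \<longleftrightarrow> (\<forall>p \<in> insert None (Some ` Qi). \<forall>u n. n > 0 \<longrightarrow>
      lin_path A Qi k p (concat (replicate n u)) p \<longrightarrow> lin_path A Qi k p u p)"

definition counter_free :: "('ap, 'q) hta \<Rightarrow> ('q set \<times> ckind) list \<Rightarrow> bool" where
  "counter_free A comps \<longleftrightarrow>
     (\<forall>(Qi, k)\<in>set comps. k \<noteq> Transient \<longrightarrow> counter_free_lin A Qi k)"

definition annots :: "('ap, 'q) hta \<Rightarrow> 'q set \<Rightarrow> ckind \<Rightarrow> 'q atom set set" where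
  "annots A Qi k = {C. \<exists>q\<in>Qi. \<exists>\<sigma> p''. lin_trans A Qi k (Some q) (\<sigma>, C) p''}"

definition visible :: "('ap, 'q) hta \<Rightarrow> ('q set \<times> ckind) list \<Rightarrow> bool" where
  "visible A comps \<longleftrightarrow> (\<forall>(Qi, k)\<in>set comps. k \<noteq> Transient \<longrightarrow>
     (\<forall>C\<in>annots A Qi k. \<forall>C'\<in>annots A Qi k. C \<noteq> C' \<longrightarrow>
        (\<exists>\<theta>\<in>C. \<exists>\<theta>'\<in>C'. hta_lang (theta_aut A \<theta>) = {t. wf_tree t} - hta_lang (theta_aut A \<theta>'))))"

end

theory Submission
  imports Defs "HOL-Library.Countable_Set"
begin

text \<open>
  Acceptance from a state of a non-transient component is a reachability condition: by
  polarisation, a state of an existential component accepts (dually, a state of a universal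
  component rejects) a node iff some finite branch from it, read with the annotations holding
  (failing) along it, leads the linearisation to its exit state. Visibility makes the annotation
  of a node unique, so the branch carries at most one word. Counter-freeness makes the monoid of
  transition relations of the linearisation aperiodic. It remains to say in the negation-free
  path language that some prefix of a branch has a given value in a finite aperiodic monoid \<open>M\<close>.
  This goes by induction on the size of \<open>M\<close> and of the alphabet, with the local divisors of
  Diekert and Kufleitner: for a letter \<open>c \<noteq> 1\<close>, cut the word at its \<open>c\<close>s. The blocks between them
  avoid \<open>c\<close>, and the sequence of blocks is evaluated in \<open>cM \<inter> Mc\<close> with the product
  \<open>uc \<circ> cv = ucv\<close>, which is smaller than \<open>M\<close> because in an aperiodic monoid only \<open>1\<close> is invertible.
\<close>

section \<open>Aperiodic monoids and definability of prefixes\<close>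

text \<open>What shapes the argument is that path formulae have neither negation nor a weak until.
  The definable sets of positions are therefore only assumed to form a lattice closed under next and
  until, and complements must come from elsewhere: as a position carries at most one letter, "the
  letter is not \<open>c\<close>" may be expressed as "the letter is one of the others". Determinism
  thus has to survive both reductions of the induction, to \<open>c\<close>-free words and to
  blocks. State formulae do have negation, so a universal component is settled by negating the
  existence of a refuting branch. The sets shown definable are those of positions from which a word
  of given value leads into a set \<open>P\<close>. With \<open>P\<close> arbitrary, concatenation
  becomes substitution: the set obtained for a later factor serves as the \<open>P\<close> of the
  factor before it. Monoids have an explicit carrier, product and unit because a local divisor
  changes all three; its unit is \<open>c\<close>.\<close>

locale aperiodic_monoid =
  fixes M :: "'m set" and mul :: "'m \<Rightarrow> 'm \<Rightarrow> 'm" (infixl "\<cdot>" 70) and e :: 'm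
  assumes finite_carrier: "finite M"
    and unit_closed: "e \<in> M"
    and mul_closed: "\<lbrakk>x \<in> M; y \<in> M\<rbrakk> \<Longrightarrow> x \<cdot> y \<in> M"
    and mul_assoc: "\<lbrakk>x \<in> M; y \<in> M; z \<in> M\<rbrakk> \<Longrightarrow> x \<cdot> y \<cdot> z = x \<cdot> (y \<cdot> z)"
    and left_unit: "x \<in> M \<Longrightarrow> e \<cdot> x = x"
    and right_unit: "x \<in> M \<Longrightarrow> x \<cdot> e = x"
    and aperiodic: "x \<in> M \<Longrightarrow> \<exists>n. ((\<cdot>) x ^^ Suc n) e = ((\<cdot>) x ^^ n) e"
begin

section \<open>Local divisors of an aperiodic monoid\<close>

definition local_carrier :: "'m \<Rightarrow> 'm set" where
  "local_carrier c = {x \<in> M. (\<exists>u\<in>M. x = u \<cdot> c) \<and> (\<exists>v\<in>M. x = c \<cdot> v)}"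

text \<open>The choice of \<open>u\<close> is irrelevant on \<open>local_carrier c\<close>, see \<open>local_mul_eq\<close>.\<close>

definition local_mul :: "'m \<Rightarrow> 'm \<Rightarrow> 'm \<Rightarrow> 'm" where
  "local_mul c x y = (SOME u. u \<in> M \<and> x = u \<cdot> c) \<cdot> y"

text \<open>Since \<open>y\<close> has \<open>c\<close> as a left factor, \<open>u \<cdot> y\<close>
  depends on \<open>u\<close> only through \<open>u \<cdot> c\<close>.\<close>

lemma local_mul_eq:
  assumes "c \<in> M" "u \<in> M" "y \<in> local_carrier c"
  shows "local_mul c (u \<cdot> c) y = u \<cdot> y"
proof -
  define u' where "u' = (SOME u'. u' \<in> M \<and> u \<cdot> c = u' \<cdot> c)"
  have u': "u' \<in> M" "u \<cdot> c = u' \<cdot> c"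
    using someI[of "\<lambda>u'. u' \<in> M \<and> u \<cdot> c = u' \<cdot> c" u] assms(2) by (auto simp: u'_def)
  obtain v where v: "v \<in> M" "y = c \<cdot> v"
    using assms(3) by (auto simp: local_carrier_def)
  have "u' \<cdot> y = u' \<cdot> c \<cdot> v" using u' v assms by (simp add: mul_assoc)
  also have "\<dots> = u \<cdot> y" using u' v assms by (metis mul_assoc)
  finally show ?thesis by (simp add: local_mul_def u'_def)
qed

lemma pow_closed: "x \<in> M \<Longrightarrow> y \<in> M \<Longrightarrow> ((\<cdot>) x ^^ n) y \<in> M"
  by (induction n) (auto intro: mul_closed)

lemma pow_mul: "x \<in> M \<Longrightarrow> y \<in> M \<Longrightarrow> ((\<cdot>) x ^^ n) e \<cdot> y = ((\<cdot>) x ^^ n) y"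
  by (induction n) (auto simp: left_unit mul_assoc pow_closed unit_closed)

lemma pow_cancel:
  assumes "c \<in> M" "v \<in> M" "c \<cdot> v = e"
  shows "((\<cdot>) c ^^ n) e \<cdot> ((\<cdot>) v ^^ n) e = e"
proof (induction n)
  case 0
  then show ?case by (simp add: left_unit unit_closed)
next
  case (Suc n)
  let ?c = "((\<cdot>) c ^^ n) e" and ?v = "((\<cdot>) v ^^ n) e"
  have mem: "?c \<in> M" "?v \<in> M" using assms(1,2) by (simp_all add: pow_closed unit_closed)
  have "((\<cdot>) c ^^ Suc n) e = ?c \<cdot> c"
    using pow_mul[of c c n] assms by (simp add: funpow_swap1 right_unit)
  then have "((\<cdot>) c ^^ Suc n) e \<cdot> ((\<cdot>) v ^^ Suc n) e = ?c \<cdot> c \<cdot> (v \<cdot> ?v)" by simp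
  also have "\<dots> = ?c \<cdot> (c \<cdot> v) \<cdot> ?v" using assms(1,2) mem by (simp add: mul_assoc mul_closed)
  finally show ?case using Suc assms mem by (simp add: right_unit)
qed

text \<open>Multiplying \<open>c^(n+1) = c^n\<close> by \<open>v^n\<close> on the right cancels all
  but one factor \<open>c\<close> on the left and everything on the right.\<close>

lemma right_invertible_eq_unit:
  assumes "c \<in> M" "v \<in> M" "c \<cdot> v = e"
  shows "c = e"
proof -
  obtain n where n: "((\<cdot>) c ^^ Suc n) e = ((\<cdot>) c ^^ n) e" using aperiodic assms by blast
  have mem: "((\<cdot>) c ^^ n) e \<in> M" "((\<cdot>) v ^^ n) e \<in> M" using assms(1,2) by (simp_all add: pow_closed unit_closed)
  have "c = c \<cdot> (((\<cdot>) c ^^ n) e \<cdot> ((\<cdot>) v ^^ n) e)" using pow_cancel[OF assms] assms by (simp add: right_unit)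
  also have "\<dots> = ((\<cdot>) c ^^ Suc n) e \<cdot> ((\<cdot>) v ^^ n) e" using mem assms by (simp add: mul_assoc)
  also have "\<dots> = e" using n pow_cancel[OF assms] by simp
  finally show ?thesis .
qed

lemma card_local_carrier:
  assumes "c \<in> M" "c \<noteq> e"
  shows "card (local_carrier c) < card M"
proof -
  have "e \<notin> local_carrier c"
    using right_invertible_eq_unit[OF assms(1)] assms(2) by (force simp: local_carrier_def)
  then have "local_carrier c \<subset> M" using unit_closed by (auto simp: local_carrier_def)
  then show ?thesis by (rule psubset_card_mono[OF finite_carrier])
qed

lemma self_mem_local: "c \<in> M \<Longrightarrow> c \<in> local_carrier c"
  using unit_closed left_unit right_unit by (force simp: local_carrier_def)

lemma local_mul_closed:
  assumes "c \<in> M" "x \<in> local_carrier c" "y \<in> local_carrier c"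
  shows "local_mul c x y \<in> local_carrier c"
proof -
  obtain u u' where u: "u \<in> M" "x = u \<cdot> c" "u' \<in> M" "x = c \<cdot> u'"
    using assms by (auto simp: local_carrier_def)
  obtain v v' where v: "v \<in> M" "y = c \<cdot> v" "v' \<in> M" "y = v' \<cdot> c"
    using assms by (auto simp: local_carrier_def)
  have eq: "local_mul c x y = u \<cdot> y" using u local_mul_eq assms by simp
  have "u \<cdot> y = c \<cdot> (u' \<cdot> v)" using u v assms(1) by (metis mul_assoc)
  moreover have "u \<cdot> y = (u \<cdot> v') \<cdot> c" using u v assms(1) by (simp add: mul_assoc)
  ultimately show ?thesis unfolding local_carrier_def eq
    using u v assms(1) mul_closed by (smt (verit) mem_Collect_eq)
qed

lemma aperiodic_monoid_local:
  assumes c: "c \<in> M"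
  shows "aperiodic_monoid (local_carrier c) (local_mul c) c"
proof
  have sub: "local_carrier c \<subseteq> M" by (auto simp: local_carrier_def)
  show "finite (local_carrier c)" using finite_subset[OF sub finite_carrier] .
  show cc: "c \<in> local_carrier c" using self_mem_local[OF c] .
  show "local_mul c x y \<in> local_carrier c" if "x \<in> local_carrier c" "y \<in> local_carrier c" for x y
    using local_mul_closed[OF c that] .
  show "local_mul c (local_mul c x y) z = local_mul c x (local_mul c y z)"
    if xyz: "x \<in> local_carrier c" "y \<in> local_carrier c" "z \<in> local_carrier c" for x y z
  proof -
    obtain u where u: "u \<in> M" "x = u \<cdot> c" using xyz by (auto simp: local_carrier_def)
    obtain v where v: "v \<in> M" "y = v \<cdot> c" using xyz by (auto simp: local_carrier_def)
    have "local_mul c x y = u \<cdot> y" using u local_mul_eq c xyz by simp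
    also have "\<dots> = u \<cdot> v \<cdot> c" using u v c by (simp add: mul_assoc)
    finally have "local_mul c (local_mul c x y) z = u \<cdot> v \<cdot> z"
      using local_mul_eq[OF c _ xyz(3)] mul_closed u v by simp
    also have "\<dots> = u \<cdot> (v \<cdot> z)" using u v xyz sub by (auto simp: mul_assoc)
    also have "\<dots> = local_mul c x (local_mul c y z)"
      using local_mul_eq[OF c v(1) xyz(3)] local_mul_eq[OF c u(1) local_mul_closed[OF c xyz(2,3)]]
        u v by simp
    finally show ?thesis .
  qed
  show "local_mul c c x = x" if "x \<in> local_carrier c" for x
    using local_mul_eq[OF c unit_closed that] c that sub by (auto simp: left_unit)
  show "local_mul c x c = x" if "x \<in> local_carrier c" for x
    using local_mul_eq[OF c _ cc] that by (auto simp: local_carrier_def)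
  show "\<exists>n. (local_mul c x ^^ Suc n) c = (local_mul c x ^^ n) c" if x: "x \<in> local_carrier c" for x
  proof -
    obtain u where u: "u \<in> M" "x = u \<cdot> c" using x by (auto simp: local_carrier_def)
    \<comment> \<open>The \<open>n\<close>-th local power of \<open>x = u \<cdot> c\<close> is
      \<open>u^n \<cdot> c\<close>, so the exponent at which the powers of \<open>u\<close> become
      stable serves for \<open>x\<close> too.\<close>
    have "(local_mul c x ^^ n) c = ((\<cdot>) u ^^ n) c \<and> (local_mul c x ^^ n) c \<in> local_carrier c" for n
    proof (induction n)
      case (Suc n)
      then show ?case using local_mul_eq[OF c u(1)] local_mul_closed[OF c x] u(2)
        by (metis comp_apply funpow.simps(2))
    qed (simp add: cc)
    then have pw: "(local_mul c x ^^ n) c = ((\<cdot>) u ^^ n) e \<cdot> c" for n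
      using pow_mul[OF u(1) c] by simp
    obtain n where "((\<cdot>) u ^^ Suc n) e = ((\<cdot>) u ^^ n) e" using aperiodic u by blast
    then show ?thesis unfolding pw by metis
  qed
qed

end

text \<open>Words do not appear, only their values. Product and unit are parameters so that the same
  relation evaluates letters in \<open>M\<close> and sequences of blocks in a local divisor.\<close>

inductive steps :: "('m \<Rightarrow> 'm \<Rightarrow> 'm) \<Rightarrow> 'm \<Rightarrow> ('x \<Rightarrow> 'm \<Rightarrow> 'x \<Rightarrow> bool) \<Rightarrow> 'x \<Rightarrow> 'm \<Rightarrow> 'x \<Rightarrow> bool"
  for mul e step where
  steps_refl: "steps mul e step x e x"
| steps_step: "step x a y \<Longrightarrow> steps mul e step y m z \<Longrightarrow> steps mul e step x (mul a m) z"

text \<open>A strong until that also demands a step at every position before the goal. So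
  \<open>until step UNIV Q\<close> says more than that \<open>Q\<close> holds eventually: a position
  at which no letter is read blocks it.\<close>

inductive_set until :: "('x \<Rightarrow> 'm \<Rightarrow> 'x \<Rightarrow> bool) \<Rightarrow> 'x set \<Rightarrow> 'x set \<Rightarrow> 'x set"
  for step P Q where
  until_now: "x \<in> Q \<Longrightarrow> x \<in> until step P Q"
| until_step: "x \<in> P \<Longrightarrow> step x a y \<Longrightarrow> y \<in> until step P Q \<Longrightarrow> x \<in> until step P Q"

definition next_in :: "('x \<Rightarrow> 'm \<Rightarrow> 'x \<Rightarrow> bool) \<Rightarrow> 'm \<Rightarrow> 'x set \<Rightarrow> 'x set" where
  "next_in step a P = {x. \<exists>y. step x a y \<and> y \<in> P}"

locale set_lattice =
  fixes \<C> :: "'x set set"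
  assumes empty_mem: "{} \<in> \<C>" and UNIV_mem: "UNIV \<in> \<C>"
    and Int_mem: "\<lbrakk>P \<in> \<C>; Q \<in> \<C>\<rbrakk> \<Longrightarrow> P \<inter> Q \<in> \<C>"
    and Un_mem: "\<lbrakk>P \<in> \<C>; Q \<in> \<C>\<rbrakk> \<Longrightarrow> P \<union> Q \<in> \<C>"
begin

lemma UN_mem: "finite I \<Longrightarrow> (\<And>i. i \<in> I \<Longrightarrow> P i \<in> \<C>) \<Longrightarrow> (\<Union>i\<in>I. P i) \<in> \<C>"
  by (induction I rule: finite_induct) (auto intro: empty_mem Un_mem)

end

text \<open>\<open>det\<close> makes up for the missing complement: a position that carries one
  letter carries no other, and the successor named by a next is the one that an until
  visits.\<close>

locale step_system = set_lattice \<C> for \<C> :: "'x set set" +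
  fixes A :: "'m set" and step :: "'x \<Rightarrow> 'm \<Rightarrow> 'x \<Rightarrow> bool"
  assumes det: "\<lbrakk>step x a y; step x b z\<rbrakk> \<Longrightarrow> a = b \<and> y = z"
    and letter: "step x a y \<Longrightarrow> a \<in> A"
    and next_mem: "\<lbrakk>a \<in> A; P \<in> \<C>\<rbrakk> \<Longrightarrow> next_in step a P \<in> \<C>"
    and until_mem: "\<lbrakk>P \<in> \<C>; Q \<in> \<C>\<rbrakk> \<Longrightarrow> until step P Q \<in> \<C>"

definition avoid :: "'m \<Rightarrow> ('x \<Rightarrow> 'm \<Rightarrow> 'x \<Rightarrow> bool) \<Rightarrow> 'x \<Rightarrow> 'm \<Rightarrow> 'x \<Rightarrow> bool" where
  "avoid c step x a y \<longleftrightarrow> step x a y \<and> a \<noteq> c"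

text \<open>A block is a \<open>c\<close>-free word followed by \<open>c\<close>. Its value in the local divisor also counts the
  \<open>c\<close> that ends the preceding block.\<close>

definition block :: "('m \<Rightarrow> 'm \<Rightarrow> 'm) \<Rightarrow> 'm \<Rightarrow> 'm \<Rightarrow> ('x \<Rightarrow> 'm \<Rightarrow> 'x \<Rightarrow> bool) \<Rightarrow> 'x \<Rightarrow> 'm \<Rightarrow> 'x \<Rightarrow> bool"
  where "block mul e c step x k y \<longleftrightarrow>
    (\<exists>m z. steps mul e (avoid c step) x m z \<and> step z c y \<and> k = mul c (mul m c))"

lemma steps_avoid_imp: "steps mul e (avoid c step) x m y \<Longrightarrow> steps mul e step x m y"
  by (induction rule: steps.induct) (auto simp: avoid_def intro: steps.intros)

lemma (in aperiodic_monoid) steps_closed: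
  "steps (\<cdot>) e step x m y \<Longrightarrow> (\<forall>x a y. step x a y \<longrightarrow> a \<in> M) \<Longrightarrow> m \<in> M"
  by (induction rule: steps.induct) (auto intro: unit_closed mul_closed)

lemma (in aperiodic_monoid) steps_append:
  "steps (\<cdot>) e step x m y \<Longrightarrow> steps (\<cdot>) e step y n z \<Longrightarrow> (\<forall>x a y. step x a y \<longrightarrow> a \<in> M) \<Longrightarrow>
   steps (\<cdot>) e step x (m \<cdot> n) z"
proof (induction rule: steps.induct)
  case (steps_refl x)
  then show ?case using left_unit steps_closed by metis
next
  case (steps_step x a y m z)
  then show ?case using mul_assoc steps_closed steps.steps_step by metis
qed

context step_system
begin

text \<open>An until over \<open>c\<close>-free steps is an until over all steps whose left argument
  is strengthened by \<open>?B\<close>, that is, by some other letter being read; by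
  \<open>det\<close> the step actually taken is then \<open>c\<close>-free.\<close>

lemma step_system_avoid:
  assumes fin: "finite A"
  shows "step_system \<C> (A - {c}) (avoid c step)"
proof
  let ?B = "\<Union>a\<in>A - {c}. next_in step a UNIV"
  show "next_in (avoid c step) a P \<in> \<C>" if "a \<in> A - {c}" "P \<in> \<C>" for a P
  proof -
    have "next_in (avoid c step) a P = next_in step a P" using that by (auto simp: next_in_def avoid_def)
    then show ?thesis using that next_mem by simp
  qed
  show "until (avoid c step) P Q \<in> \<C>" if "P \<in> \<C>" "Q \<in> \<C>" for P Q
  proof -
    have "x \<in> until step (P \<inter> ?B) Q" if "x \<in> until (avoid c step) P Q" for x
      using that
    proof induction
      case (until_step x a y)
      then have "x \<in> ?B" using letter by (auto simp: next_in_def avoid_def)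
      with until_step show ?case by (auto simp: avoid_def intro: until.until_step)
    qed (rule until_now)
    moreover have "x \<in> until (avoid c step) P Q" if "x \<in> until step (P \<inter> ?B) Q" for x
      using that
    proof induction
      case (until_step x a y)
      then have "avoid c step x a y" using det by (force simp: next_in_def avoid_def)
      with until_step show ?case by (blast intro: until.until_step)
    qed (rule until_now)
    ultimately have "until (avoid c step) P Q = until step (P \<inter> ?B) Q" by blast
    moreover have "?B \<in> \<C>" using fin by (intro UN_mem next_mem UNIV_mem) auto
    ultimately show ?thesis using that by (simp add: until_mem Int_mem)
  qed
qed (use det letter in \<open>auto simp: avoid_def\<close>)

text \<open>Both runs must stop at the first \<open>c\<close> after \<open>x\<close>: before it
  neither can read \<open>c\<close>, at it neither can continue. This makes the block system
  deterministic again.\<close>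

lemma block_source_det:
  assumes "steps mul e (avoid c step) x m z" "step z c y"
    "steps mul e (avoid c step) x m' z'" "step z' c y'"
  shows "m = m' \<and> y = y'"
  using assms
proof (induction arbitrary: m' rule: steps.induct)
  case (steps_refl x)
  from steps_refl(2) show ?case
  proof cases
    case steps_refl
    then show ?thesis using \<open>step x c y\<close> \<open>step z' c y'\<close> det by blast
  next
    case (steps_step a w n)
    then show ?thesis using \<open>step x c y\<close> det by (auto simp: avoid_def)
  qed
next
  case (steps_step x a w n z)
  from steps_step.prems(2) show ?case
  proof cases
    case steps_refl
    then show ?thesis using steps_step det by (auto simp: avoid_def)
  next
    case (steps_step b w' n')
    then have "b = a" "w' = w" using steps_step.hyps(1) det \<open>avoid c step x a w\<close> by (auto simp: avoid_def)
    then show ?thesis using steps_step steps_step.prems \<open>step z c y\<close> \<open>step z' c y'\<close>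
      using steps_step.IH by blast
  qed
qed

text \<open>An until over blocks: every position reached by a \<open>c\<close>-step must satisfy \<open>P\<close> before the
  \<open>c\<close>-step into \<open>Q\<close>.\<close>

lemma until_block:
  assumes fin: "finite A" and c: "c \<in> A"
  shows "until (block mul e c step) P Q =
    Q \<union> (P \<inter> until step ((\<Union>a\<in>A - {c}. next_in step a UNIV) \<union> next_in step c P) (next_in step c Q))"
    (is "?L = Q \<union> (P \<inter> until step ?R ?S)")
proof
  have run: "x \<in> until step ?R ?S"
    if "steps mul e (avoid c step) x m z" "z \<in> until step ?R ?S" for x m z
    using that
  proof (induction rule: steps.induct)
    case (steps_step x a y m z)
    then show ?case using letter
      by (intro until_step[of x _ _ a y]) (auto simp: avoid_def next_in_def)
  qed
  show "?L \<subseteq> Q \<union> (P \<inter> until step ?R ?S)"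
  proof
    fix x assume "x \<in> ?L"
    then show "x \<in> Q \<union> (P \<inter> until step ?R ?S)"
    proof induction
      case (until_step x k y)
      obtain m z where z: "steps mul e (avoid c step) x m z" "step z c y"
        using until_step(2) by (auto simp: block_def)
      have "z \<in> until step ?R ?S"
      proof (cases "y \<in> Q")
        case True
        then show ?thesis using z by (auto simp: next_in_def intro: until_now)
      next
        case False
        then show ?thesis using z until_step by (auto simp: next_in_def intro!: until.until_step[of z _ _ c y])
      qed
      then show ?case using run z until_step by blast
    qed simp
  qed
  have "\<exists>m z y. steps mul e (avoid c step) x m z \<and> step z c y \<and> y \<in> ?L"
    if "x \<in> until step ?R ?S" for x
    using that
  proof induction
    case (until_now x)
    then show ?case by (auto simp: next_in_def intro: steps_refl until.until_now)
  next
    case (until_step x a y)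
    then obtain m z w where w: "steps mul e (avoid c step) y m z" "step z c w" "w \<in> ?L" by blast
    show ?case
    proof (cases "a = c")
      case True
      \<comment> \<open>A position of \<open>?R\<close> that reads \<open>c\<close> reads no other
        letter, so it must be in \<open>next_in step c P\<close>, and its successor there can only
        be \<open>y\<close>. Hence a new block may start at \<open>y\<close>.\<close>
      then have "y \<in> P" using until_step det unfolding next_in_def by blast
      have "block mul e c step y (mul c (mul m c)) w" using w by (auto simp: block_def)
      from until.until_step[OF \<open>y \<in> P\<close> this w(3)] have "y \<in> ?L" .
      then show ?thesis using True until_step by (blast intro: steps_refl)
    next
      case False
      then have "steps mul e (avoid c step) x (mul a m) z"
        using until_step w by (auto simp: avoid_def intro: steps_step)
      then show ?thesis using w by blast
    qed
  qed
  then have "x \<in> ?L" if "x \<in> P" "x \<in> until step ?R ?S" for x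
    using that until_step[of x P "block mul e c step"] unfolding block_def by blast
  then show "Q \<union> (P \<inter> until step ?R ?S) \<subseteq> ?L"
    using until_now[of _ Q] by blast
qed

end

text \<open>The premise \<open>avoid\<close> is the induction hypothesis for the alphabet without
  \<open>c\<close>. It makes a single block step definable, as a union over the finitely many values
  \<open>m\<close> of the \<open>c\<close>-free part with
  \<open>k = c \<cdot> (m \<cdot> c)\<close>.\<close>

lemma (in aperiodic_monoid) step_system_block:
  assumes sys: "step_system \<C> A step" and A: "A \<subseteq> M" and c: "c \<in> A"
    and avoid: "\<And>m P. P \<in> \<C> \<Longrightarrow> {x. \<exists>y\<in>P. steps (\<cdot>) e (avoid c step) x m y} \<in> \<C>"
  shows "step_system \<C> (local_carrier c) (block (\<cdot>) e c step)"
proof -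
  interpret step_system \<C> A step by fact
  have finA: "finite A" using A finite_carrier finite_subset by blast
  have letM: "\<forall>x a y. avoid c step x a y \<longrightarrow> a \<in> M" using letter A by (auto simp: avoid_def)
  show ?thesis
  proof
    show "a = b \<and> y = z" if "block (\<cdot>) e c step x a y" "block (\<cdot>) e c step x b z" for x a y b z
      using that block_source_det unfolding block_def by blast
    show "a \<in> local_carrier c" if ab: "block (\<cdot>) e c step x a y" for x a y
    proof -
      obtain m z where m: "steps (\<cdot>) e (avoid c step) x m z" "a = c \<cdot> (m \<cdot> c)"
        using ab by (auto simp: block_def)
      have "m \<in> M" "c \<in> M" using steps_closed[OF m(1)] letM A c by auto
      then have "c \<cdot> m \<in> M" "m \<cdot> c \<in> M" "a \<in> M" "a = c \<cdot> m \<cdot> c"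
        using m by (auto simp: mul_closed mul_assoc)
      then show ?thesis using m(2) unfolding local_carrier_def by blast
    qed
    show "next_in (block (\<cdot>) e c step) k P \<in> \<C>" if "P \<in> \<C>" for k P
    proof -
      have "next_in (block (\<cdot>) e c step) k P =
        (\<Union>m\<in>{m \<in> M. k = c \<cdot> (m \<cdot> c)}. {x. \<exists>z\<in>next_in step c P. steps (\<cdot>) e (avoid c step) x m z})"
        using steps_closed[OF _ letM] unfolding next_in_def block_def by blast
      also have "\<dots> \<in> \<C>" using that c finite_carrier by (intro UN_mem avoid next_mem) auto
      finally show ?thesis .
    qed
    show "until (block (\<cdot>) e c step) P Q \<in> \<C>" if "P \<in> \<C>" "Q \<in> \<C>" for P Q
      unfolding until_block[OF finA c] using that c finA
      by (intro Un_mem Int_mem until_mem UN_mem next_mem UNIV_mem) auto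
  qed
qed

text \<open>The surplus \<open>c\<close> in \<open>k = c \<cdot> n\<close> is the one read just
  before the first block. The empty sequence has the local unit \<open>c = c \<cdot> e\<close>, and
  the local product of \<open>c \<cdot> m \<cdot> c\<close> and \<open>c \<cdot> n\<close> keeps
  only one of the two copies of \<open>c\<close> that meet.\<close>

lemma (in aperiodic_monoid) steps_block_imp:
  assumes letM: "\<forall>x a y. step x a y \<longrightarrow> a \<in> M" and c: "c \<in> M"
    and "steps (local_mul c) c (block (\<cdot>) e c step) x k y"
  shows "k \<in> local_carrier c \<and> (\<exists>n\<in>M. k = c \<cdot> n \<and> steps (\<cdot>) e step x n y)"
  using assms(3)
proof (induction rule: steps.induct)
  case (steps_refl x)
  then show ?case using self_mem_local[OF c] c unit_closed right_unit
    by (metis steps.steps_refl)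
next
  case (steps_step x a y k z)
  obtain m w where m: "steps (\<cdot>) e (avoid c step) x m w" "step w c y" "a = c \<cdot> (m \<cdot> c)"
    using steps_step(1) by (auto simp: block_def)
  have mM: "m \<in> M" using steps_closed[OF steps_avoid_imp[OF m(1)] letM] .
  obtain n where n: "n \<in> M" "k = c \<cdot> n" "steps (\<cdot>) e step y n z" using steps_step by blast
  have a: "a = c \<cdot> m \<cdot> c" "a \<in> local_carrier c"
  proof -
    show "a = c \<cdot> m \<cdot> c" using m mM c by (simp add: mul_assoc)
    then show "a \<in> local_carrier c" using m(3) mM c mul_closed unfolding local_carrier_def by blast
  qed
  have "local_mul c a k = c \<cdot> m \<cdot> k"
    unfolding a(1) using local_mul_eq[of c "c \<cdot> m" k] c mM mul_closed steps_step by auto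
  also have "\<dots> = c \<cdot> (m \<cdot> (c \<cdot> n))" using c mM n by (simp add: mul_assoc mul_closed)
  finally have "local_mul c a k = c \<cdot> (m \<cdot> (c \<cdot> n))" .
  moreover have "steps (\<cdot>) e step x (m \<cdot> (c \<cdot> n)) z"
    using steps_append[OF steps_avoid_imp[OF m(1)] _ letM] steps.steps_step[of step, OF m(2) n(3)] by blast
  moreover have "local_mul c a k \<in> local_carrier c"
    using local_mul_closed c a steps_step by blast
  ultimately show ?case using c mM n mul_closed by blast
qed

text \<open>A word containing \<open>c\<close> is cut at its first and its last \<open>c\<close>.
  The outer factors \<open>m0\<close> and \<open>m1\<close> are \<open>c\<close>-free;
  \<open>k\<close> is the value of everything from the first \<open>c\<close> to the last, both
  included, which is what the blocks after the first \<open>c\<close> evaluate to. If there is only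
  one \<open>c\<close>, there are no blocks and \<open>k = c\<close>.\<close>

lemma (in aperiodic_monoid) steps_decompose:
  assumes letM: "\<forall>x a y. step x a y \<longrightarrow> a \<in> M" and c: "c \<in> M"
  shows "steps (\<cdot>) e step x m z \<longleftrightarrow> steps (\<cdot>) e (avoid c step) x m z \<or>
    (\<exists>m0\<in>M. \<exists>k\<in>local_carrier c. \<exists>m1\<in>M. m = m0 \<cdot> k \<cdot> m1 \<and>
      (\<exists>x1 y y'. steps (\<cdot>) e (avoid c step) x m0 x1 \<and> step x1 c y \<and>
        steps (local_mul c) c (block (\<cdot>) e c step) y k y' \<and> steps (\<cdot>) e (avoid c step) y' m1 z))"
    (is "_ \<longleftrightarrow> _ \<or> ?D x m z")
proof
  have letA: "\<forall>x a y. avoid c step x a y \<longrightarrow> a \<in> M" using letM by (auto simp: avoid_def)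
  have sub: "local_carrier c \<subseteq> M" by (auto simp: local_carrier_def)
  show "steps (\<cdot>) e (avoid c step) x m z \<or> ?D x m z" if "steps (\<cdot>) e step x m z"
    using that
  proof (induction rule: steps.induct)
    case (steps_refl x)
    then show ?case by (blast intro: steps.steps_refl)
  next
    case (steps_step x a y m z)
    have aM: "a \<in> M" using steps_step letM by blast
    from steps_step.IH show ?case
    proof
      assume y: "steps (\<cdot>) e (avoid c step) y m z"
      show ?thesis
      proof (cases "a = c")
        case True
        have "m \<in> M" using steps_closed[OF y letA] .
        moreover have "c \<in> local_carrier c" using self_mem_local[OF c] .
        moreover have "a \<cdot> m = e \<cdot> c \<cdot> m" using True c left_unit by simp
        ultimately have "?D x (a \<cdot> m) z"
          using y True steps_step.hyps(1) unit_closed by (blast intro: steps.steps_refl)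
        then show ?thesis ..
      next
        case False
        then have "steps (\<cdot>) e (avoid c step) x (a \<cdot> m) z"
          using y steps_step by (auto simp: avoid_def intro: steps.steps_step)
        then show ?thesis ..
      qed
    next
      assume "?D y m z"
      then obtain m0 k m1 x1 w y' where d: "m0 \<in> M" "k \<in> local_carrier c" "m1 \<in> M" "m = m0 \<cdot> k \<cdot> m1"
        "steps (\<cdot>) e (avoid c step) y m0 x1" "step x1 c w"
        "steps (local_mul c) c (block (\<cdot>) e c step) w k y'" "steps (\<cdot>) e (avoid c step) y' m1 z"
        by blast
      have kM: "k \<in> M" using d sub by blast
      have "?D x (a \<cdot> m) z"
      proof (cases "a = c")
        case True
        \<comment> \<open>With a new \<open>c\<close> in front, the former \<open>c\<close>-free
          head and the \<open>c\<close> after it turn into one more block, and the new head is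
          empty.\<close>
        have b: "block (\<cdot>) e c step y (c \<cdot> (m0 \<cdot> c)) w" using d by (auto simp: block_def)
        have eq: "local_mul c (c \<cdot> (m0 \<cdot> c)) k = c \<cdot> m0 \<cdot> k"
          using local_mul_eq[of c "c \<cdot> m0" k] c d mul_closed mul_assoc by simp
        have s: "steps (local_mul c) c (block (\<cdot>) e c step) y (c \<cdot> m0 \<cdot> k) y'"
          using steps.steps_step[of "block (\<cdot>) e c step" y "c \<cdot> (m0 \<cdot> c)" w "local_mul c", OF b d(7)]
          unfolding eq .
        have "c \<cdot> m0 \<cdot> k \<in> local_carrier c" using steps_block_imp[OF letM c s] by blast
        moreover have "a \<cdot> m = e \<cdot> (c \<cdot> m0 \<cdot> k) \<cdot> m1"
          using True c d kM by (simp add: mul_assoc mul_closed left_unit)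
        ultimately show ?thesis
          using s d(3,8) True steps_step.hyps(1) unit_closed by (blast intro: steps.steps_refl)
      next
        case False
        then have "steps (\<cdot>) e (avoid c step) x (a \<cdot> m0) x1"
          using d steps_step by (auto simp: avoid_def intro: steps.steps_step)
        moreover have "a \<cdot> m = a \<cdot> m0 \<cdot> k \<cdot> m1" using d aM kM by (simp add: mul_assoc mul_closed)
        moreover have "a \<cdot> m0 \<in> M" using aM d mul_closed by blast
        ultimately show ?thesis using d by blast
      qed
      then show ?thesis ..
    qed
  qed
  show "steps (\<cdot>) e step x m z" if "steps (\<cdot>) e (avoid c step) x m z \<or> ?D x m z"
    using that
  proof
    assume "?D x m z"
    then obtain m0 k m1 x1 w y' where d: "m0 \<in> M" "k \<in> local_carrier c" "m1 \<in> M" "m = m0 \<cdot> k \<cdot> m1"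
      "steps (\<cdot>) e (avoid c step) x m0 x1" "step x1 c w"
      "steps (local_mul c) c (block (\<cdot>) e c step) w k y'" "steps (\<cdot>) e (avoid c step) y' m1 z"
      by blast
    obtain n where n: "n \<in> M" "k = c \<cdot> n" "steps (\<cdot>) e step w n y'"
      using steps_block_imp[OF letM c d(7)] by blast
    have "steps (\<cdot>) e step x1 (c \<cdot> n) y'" using steps.steps_step[of step, OF d(6) n(3)] .
    then have "steps (\<cdot>) e step x (m0 \<cdot> k) y'"
      using steps_append[OF steps_avoid_imp[OF d(5)] _ letM] n by blast
    then show ?thesis using steps_append[OF _ steps_avoid_imp[OF d(8)] letM] d by blast
  qed (rule steps_avoid_imp)
qed

text \<open>The measure is lexicographic. Removing \<open>c\<close> from the alphabet keeps
  \<open>M\<close>; passing to blocks may enlarge the alphabet, to all of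
  \<open>local_carrier c\<close>, but then the monoid has become smaller.\<close>

lemma steps_definable:
  assumes "aperiodic_monoid M mul e" "step_system \<C> A step" "A \<subseteq> M" "P \<in> \<C>"
  shows "{x. \<exists>y\<in>P. steps mul e step x m y} \<in> \<C>"
  using assms
proof (induction "card M" arbitrary: M mul e A step P m rule: less_induct)
  case (less M mul e)
  interpret aperiodic_monoid M mul e by fact
  note IH = less.hyps
  from less.prems(2-) show ?case
  proof (induction "card A" arbitrary: A step P m rule: less_induct)
    case (less A)
    interpret step_system \<C> A step by fact
    have letM: "\<forall>x a y. step x a y \<longrightarrow> a \<in> M" using letter less.prems by blast
    have finA: "finite A" using less.prems finite_carrier finite_subset by blast
    show ?case
    proof (cases "A \<subseteq> {e}")
      case True
      \<comment> \<open>If \<open>e\<close> is the only possible letter, every word has value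
        \<open>e\<close>, and reaching \<open>P\<close> at all is an until with trivial left
        argument.\<close>
      have "m = e \<and> x \<in> until step UNIV P" if "steps mul e step x m y" "y \<in> P" for x m y
        using that
      proof (induction rule: steps.induct)
        case (steps_step x a y m z)
        then have "a = e" using letter True by blast
        then show ?case using steps_step left_unit unit_closed by (auto intro: until_step)
      qed (auto intro: until_now)
      moreover have "\<exists>y\<in>P. steps mul e step x e y" if "x \<in> until step UNIV P" for x
        using that
      proof induction
        case (until_step x a y)
        then obtain z where z: "z \<in> P" "steps mul e step y e z" by blast
        have "a = e" using until_step letter True by blast
        then have "steps mul e step x (mul e e) z" using steps.steps_step z until_step by metis
        then show ?case using z left_unit unit_closed by auto
      qed (auto intro: steps_refl)
      ultimately have "{x. \<exists>y\<in>P. steps mul e step x m y} = (if m = e then until step UNIV P else {})"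
        by auto
      then show ?thesis using less.prems until_mem UNIV_mem empty_mem by auto
    next
      case False
      then obtain c where c: "c \<in> A" "c \<noteq> e" by blast
      then have cM: "c \<in> M" using less.prems by blast
      have avoid: "{x. \<exists>y\<in>P. steps mul e (avoid c step) x m y} \<in> \<C>" if "P \<in> \<C>" for P m
      proof (rule less.hyps[OF _ step_system_avoid[OF finA, of c]])
        show "card (A - {c}) < card A" using c finA by (meson card_Diff1_less)
      qed (use less.prems that in auto)
      have block: "{x. \<exists>y\<in>P. steps (local_mul c) c (block mul e c step) x k y} \<in> \<C>" if "P \<in> \<C>" for P k
        by (rule IH[OF card_local_carrier[OF cM c(2)] aperiodic_monoid_local[OF cM]
          step_system_block[OF less.prems(1,2) c(1) avoid] subset_refl that])
      let ?I = "{(m0, k, m1). m0 \<in> M \<and> k \<in> local_carrier c \<and> m1 \<in> M \<and> m = mul (mul m0 k) m1}"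
      \<comment> \<open>The factors are nested from the last to the first: each set of starting
        positions is the target of the factor before it.\<close>
      let ?F = "\<lambda>(m0, k, m1). {x. \<exists>x1\<in>next_in step c
          {y. \<exists>y'\<in>{y'. \<exists>z\<in>P. steps mul e (avoid c step) y' m1 z}.
             steps (local_mul c) c (block mul e c step) y k y'}. steps mul e (avoid c step) x m0 x1}"
      have decomp: "{x. \<exists>y\<in>P. steps mul e step x m y} =
        {x. \<exists>y\<in>P. steps mul e (avoid c step) x m y} \<union> (\<Union>i\<in>?I. ?F i)"
        unfolding steps_decompose[of step, OF letM cM] by (fastforce simp: next_in_def)
      have finI: "finite ?I"
        by (rule finite_subset[of _ "M \<times> M \<times> M"]) (auto simp: local_carrier_def finite_carrier)
      have F: "?F i \<in> \<C>" for i
        using less.prems c by (cases i) (simp only: prod.case, intro avoid block next_mem)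
      show ?thesis unfolding decomp by (intro Un_mem UN_mem avoid less.prems(3) finI F)
    qed
  qed
qed

section \<open>A fixpoint-free semantics of hesitant automata\<close>

text \<open>\<open>sat_atom\<close> with the run abstracted to a predicate. \<open>P\<close> is
  later instantiated by the labels below a run node, by the semantics of states, and by the moves of
  a strategy.\<close>

fun hold_atom :: "'ap tree \<Rightarrow> nat list \<Rightarrow> ('q \<Rightarrow> nat list \<Rightarrow> bool) \<Rightarrow> 'q atom \<Rightarrow> bool" where
  "hold_atom t v P (Dia k, q) =
     (\<exists>S. S \<subseteq> children (fst t) v \<and> finite S \<and> card S = k \<and> (\<forall>w\<in>S. P q w))"
| "hold_atom t v P (Box k, q) =
     (\<exists>S. S \<subseteq> children (fst t) v \<and> finite S \<and> card S < k \<and> (\<forall>w\<in>children (fst t) v - S. P q w))"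

lemma sat_atom_eq:
  "sat_atom t Dr r x a = hold_atom t (snd (r x)) (\<lambda>q v. \<exists>y\<in>children Dr x. r y = (q, v)) a"
  by (cases "(t, Dr, r, x, a)" rule: sat_atom.cases) auto

lemma hold_atom_mono:
  assumes "hold_atom t v P a" "\<And>w. w \<in> children (fst t) v \<Longrightarrow> P (snd a) w \<Longrightarrow> P' (snd a) w"
  shows "hold_atom t v P' a"
proof (cases "(t, v, P, a)" rule: hold_atom.cases)
  case (1 t v P k q)
  then show ?thesis using assms by simp (metis in_mono)
next
  case (2 t v P k q)
  then show ?thesis using assms by simp (metis DiffD1 DiffD2 Diff_iff)
qed

lemma hold_atom_cong:
  assumes "\<And>w. w \<in> children (fst t) v \<Longrightarrow> P (snd a) w = P' (snd a) w"
  shows "hold_atom t v P a = hold_atom t v P' a"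
  using assms hold_atom_mono[of t v P a P'] hold_atom_mono[of t v P' a P] by blast

lemma hold_atom_Dia1: "hold_atom t v P (Dia (Suc 0), q) \<longleftrightarrow> (\<exists>w\<in>children (fst t) v. P q w)"
proof
  assume "hold_atom t v P (Dia (Suc 0), q)"
  then show "\<exists>w\<in>children (fst t) v. P q w" by (auto simp: card_Suc_eq)
next
  assume "\<exists>w\<in>children (fst t) v. P q w"
  then obtain w where "w \<in> children (fst t) v" "P q w" by blast
  then show "hold_atom t v P (Dia (Suc 0), q)" by (auto intro!: exI[of _ "{w}"])
qed

lemma hold_atom_Box1: "hold_atom t v P (Box (Suc 0), q) \<longleftrightarrow> (\<forall>w\<in>children (fst t) v. P q w)"
  by auto

lemma finite_set_pbf: "finite (set_pbf b)"
  by (induction b) auto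

lemma sat_pbf_mono:
  "sat_pbf f b \<Longrightarrow> (\<And>a. a \<in> set_pbf b \<Longrightarrow> f a \<Longrightarrow> g a) \<Longrightarrow> sat_pbf g b"
  by (induction b) auto

lemma sat_pbf_cong: "(\<And>a. a \<in> set_pbf b \<Longrightarrow> f a = g a) \<Longrightarrow> sat_pbf f b = sat_pbf g b"
  using sat_pbf_mono[of f b g] sat_pbf_mono[of g b f] by blast

lemma sat_pbf_map: "sat_pbf f (map_pbf h b) = sat_pbf (f \<circ> h) b"
  by (induction b) auto

lemma sat_pbf_dnf: "sat_pbf f b \<longleftrightarrow> (\<exists>c\<in>dnf b. \<forall>a\<in>c. f a)"
proof (induction b)
  case (BAnd b1 b2)
  then show ?case by simp (metis Un_iff)
qed auto

lemma sat_pbf_cnf: "sat_pbf f b \<longleftrightarrow> (\<forall>c\<in>cnf b. \<exists>a\<in>c. f a)"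
proof (induction b)
  case (BOr b1 b2)
  then show ?case by simp (metis Un_iff)
qed auto

lemma dnf_subset: "c \<in> dnf b \<Longrightarrow> c \<subseteq> set_pbf b"
  by (induction b arbitrary: c) fastforce+

lemma cnf_subset: "c \<in> cnf b \<Longrightarrow> c \<subseteq> set_pbf b"
  by (induction b arbitrary: c) fastforce+

definition clauses :: "ckind \<Rightarrow> 'x pbf \<Rightarrow> 'x set set" where
  "clauses k = (if k = Existential then dnf else cnf)"

definition step_mod :: "ckind \<Rightarrow> modality" where
  "step_mod k = (if k = Existential then Dia 1 else Box 1)"

lemma clauses_subset: "c \<in> clauses k b \<Longrightarrow> c \<subseteq> set_pbf b"
  using dnf_subset[of c b] cnf_subset[of c b] by (auto simp: clauses_def split: if_splits)

lemma lin_trans_Some: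
  "lin_trans A Qi k (Some q) (\<sigma>, C) p \<longleftrightarrow> k \<noteq> Transient \<and> q \<in> Qi \<and> (\<forall>a\<in>C. snd a \<notin> Qi) \<and>
    (case p of None \<Rightarrow> C \<in> clauses k (delta A q \<sigma>)
     | Some q' \<Rightarrow> q' \<in> Qi \<and> insert (step_mod k, q') C \<in> clauses k (delta A q \<sigma>))"
  unfolding lin_trans_def clauses_def step_mod_def Let_def
  by (cases p) (auto split: if_splits)

text \<open>In an existential component all atoms of an annotation have to hold, in a universal one all
  have to fail, since there the linearisation tracks a refutation.\<close>

definition annot_ok :: "ckind \<Rightarrow> ('x \<Rightarrow> bool) \<Rightarrow> 'x set \<Rightarrow> bool" where
  "annot_ok k f C \<longleftrightarrow> (\<forall>a\<in>C. f a \<longleftrightarrow> k = Existential)"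

text \<open>The \<open>n\<close>-th approximation of a least fixpoint, for both kinds. In a
  universal component a step chooses a CNF clause all of whose atoms are to fail, and its
  \<open>Box 1\<close> atom fails at a single child; thus a refutation is a branch as well.\<close>

primrec exit_in :: "('ap, 'q) hta \<Rightarrow> 'q set \<Rightarrow> ckind \<Rightarrow> 'ap tree \<Rightarrow> ('q \<Rightarrow> nat list \<Rightarrow> bool) \<Rightarrow> nat \<Rightarrow>
    'q \<Rightarrow> nat list \<Rightarrow> bool" where
  "exit_in A Qi k t Z 0 = (\<lambda>q v. False)"
| "exit_in A Qi k t Z (Suc n) = (\<lambda>q v. \<exists>C p. lin_trans A Qi k (Some q) (snd t v, C) p \<and>
     annot_ok k (hold_atom t v Z) C \<and>
     (case p of None \<Rightarrow> True | Some q' \<Rightarrow> \<exists>w\<in>children (fst t) v. exit_in A Qi k t Z n q' w))"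

text \<open>Stage \<open>Suc i\<close> settles component \<open>i\<close>, whose transitions leave
  it only towards components settled earlier. So no nested fixpoints arise: \<open>Z\<close> is
  fixed while the branches of one component are explored.\<close>

primrec sem_upto :: "('ap, 'q) hta \<Rightarrow> ('q set \<times> ckind) list \<Rightarrow> 'ap tree \<Rightarrow> nat \<Rightarrow> 'q \<Rightarrow> nat list \<Rightarrow> bool"
  where
  "sem_upto A comps t 0 = (\<lambda>q v. False)"
| "sem_upto A comps t (Suc i) = (\<lambda>q v.
     if q \<in> fst (comps ! i) then
       (case snd (comps ! i) of
          Transient \<Rightarrow> sat_pbf (hold_atom t v (sem_upto A comps t i)) (delta A q (snd t v))
        | Existential \<Rightarrow> \<exists>n. exit_in A (fst (comps ! i)) Existential t (sem_upto A comps t i) n q v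
        | Universal \<Rightarrow> \<not> (\<exists>n. exit_in A (fst (comps ! i)) Universal t (sem_upto A comps t i) n q v))
     else sem_upto A comps t i q v)"

definition sem :: "('ap, 'q) hta \<Rightarrow> ('q set \<times> ckind) list \<Rightarrow> 'ap tree \<Rightarrow> 'q \<Rightarrow> nat list \<Rightarrow> bool" where
  "sem A comps t = sem_upto A comps t (length comps)"

lemma exit_in_cong:
  assumes "q \<in> Qi"
    and "\<And>q \<sigma> a w. q \<in> Qi \<Longrightarrow> a \<in> set_pbf (delta A q \<sigma>) \<Longrightarrow> snd a \<notin> Qi \<Longrightarrow> Z (snd a) w = Z' (snd a) w"
  shows "exit_in A Qi k t Z n q v = exit_in A Qi k t Z' n q v"
  using assms(1)
proof (induction n arbitrary: q v)
  case (Suc n)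
  have "annot_ok k (hold_atom t v Z) C = annot_ok k (hold_atom t v Z') C \<and>
      (case p of None \<Rightarrow> True | Some q' \<Rightarrow> \<exists>w\<in>children (fst t) v. exit_in A Qi k t Z n q' w) =
      (case p of None \<Rightarrow> True | Some q' \<Rightarrow> \<exists>w\<in>children (fst t) v. exit_in A Qi k t Z' n q' w)"
    if "lin_trans A Qi k (Some q) (snd t v, C) p" for C p
  proof -
    have "C \<subseteq> set_pbf (delta A q (snd t v))" "\<forall>a\<in>C. snd a \<notin> Qi"
      using that clauses_subset by (fastforce simp: lin_trans_Some split: option.splits)+
    then have "hold_atom t v Z a = hold_atom t v Z' a" if "a \<in> C" for a
      using that assms(2)[OF Suc.prems] by (intro hold_atom_cong) blast
    then show ?thesis using Suc.IH that
      by (cases p) (simp_all add: annot_ok_def lin_trans_Some)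
  qed
  then show ?case unfolding exit_in.simps by (intro ex_cong1 conj_cong refl) blast+
qed simp

locale hesitant_aut =
  fixes A :: "('ap, 'q) hta" and comps :: "('q set \<times> ckind) list"
  assumes wf: "hta_wf A" and hes: "hesitant A comps" and pol: "polarised A comps"
begin

definition idx :: "'q \<Rightarrow> nat" where
  "idx q = (THE i. i < length comps \<and> q \<in> fst (comps ! i))"

abbreviation comp :: "'q \<Rightarrow> 'q set" where "comp q \<equiv> fst (comps ! idx q)"
abbreviation knd :: "'q \<Rightarrow> ckind" where "knd q \<equiv> snd (comps ! idx q)"

lemma idx_eq: "i < length comps \<Longrightarrow> q \<in> fst (comps ! i) \<Longrightarrow> idx q = i"
  unfolding idx_def using hes by (intro the_equality) (auto simp: hesitant_def)

lemma idx_states: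
  assumes "q \<in> states A"
  shows "idx q < length comps" "q \<in> comp q"
proof -
  obtain i where i: "i < length comps" "q \<in> fst (comps ! i)"
    using assms hes unfolding hesitant_def by (metis UN_E in_set_conv_nth)
  then show "idx q < length comps" "q \<in> comp q" using idx_eq[OF i] by auto
qed

lemma comp_states: "i < length comps \<Longrightarrow> q \<in> fst (comps ! i) \<Longrightarrow> q \<in> states A"
  using hes unfolding hesitant_def by (metis UnionI image_eqI nth_mem)

lemma mem_comp: "q \<in> states A \<Longrightarrow> q' \<in> comp q \<longleftrightarrow> q' \<in> states A \<and> idx q' = idx q"
  using idx_states idx_eq comp_states by metis

lemma delta_states:
  assumes "q \<in> states A" "a \<in> set_pbf (delta A q \<sigma>)"
  shows "snd a \<in> states A" "idx (snd a) \<le> idx q"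
proof -
  obtain j where "j \<le> idx q" "snd a \<in> fst (comps ! j)"
    using hes idx_states[OF assms(1)] assms(2) unfolding hesitant_def by meson
  then show "snd a \<in> states A" "idx (snd a) \<le> idx q"
    using idx_eq[of j "snd a"] comp_states[of j "snd a"] idx_states[OF assms(1)] by auto
qed

lemma kind_ok_comp: "q \<in> states A \<Longrightarrow> kind_ok A (comp q, knd q)"
  using hes idx_states unfolding hesitant_def by auto

lemma transient_less:
  "q \<in> states A \<Longrightarrow> knd q = Transient \<Longrightarrow> a \<in> set_pbf (delta A q \<sigma>) \<Longrightarrow> idx (snd a) < idx q"
  using kind_ok_comp[of q] idx_states[of q] delta_states[of q a \<sigma>] mem_comp[of q "snd a"]
  by (auto simp: le_less)

text \<open>By hesitancy a clause contains at most one atom of the component itself, and of the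
  right modality; what remains of the clause is the annotation.\<close>

lemma clause_split:
  assumes q: "q \<in> states A" and k: "knd q \<noteq> Transient" and c: "c \<in> clauses (knd q) (delta A q \<sigma>)"
  shows "lin_trans A (comp q) (knd q) (Some q) (\<sigma>, c) None \<or>
    (\<exists>C q'. c = insert (step_mod (knd q), q') C \<and>
       lin_trans A (comp q) (knd q) (Some q) (\<sigma>, C) (Some q'))"
proof -
  let ?I = "{a \<in> c. snd a \<in> comp q}"
  have ok: "(\<forall>a\<in>c. snd a \<in> comp q \<longrightarrow> fst a = step_mod (knd q)) \<and> card ?I \<le> 1"
    using kind_ok_comp[OF q] c k idx_states[OF q]
    by (cases "knd q") (auto simp: clauses_def step_mod_def)
  \<comment> \<open>Finiteness matters because \<open>card\<close> is 0 on infinite sets, so that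
    the bound in \<open>kind_ok\<close> alone would not exclude them.\<close>
  have "finite c" using clauses_subset[OF c] finite_set_pbf finite_subset by blast
  then have fin: "finite ?I" by simp
  show ?thesis
  proof (cases "?I = {}")
    case True
    then show ?thesis using c k idx_states[OF q] by (auto simp: lin_trans_Some)
  next
    case False
    then have "0 < card ?I" using fin by (simp only: card_gt_0_iff) simp
    then have "card ?I = 1" using ok by linarith
    then obtain a where a: "?I = {a}" by (auto simp: card_1_singleton_iff)
    then have aI: "a \<in> c" "snd a \<in> comp q" by blast+
    then have "a = (step_mod (knd q), snd a)" using ok by (metis prod.collapse)
    moreover have "c = insert a (c - {a})" using aI by blast
    moreover have "\<forall>b\<in>c - {a}. snd b \<notin> comp q" using a by blast
    ultimately have "c = insert (step_mod (knd q), snd a) (c - {a})"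
      "lin_trans A (comp q) (knd q) (Some q) (\<sigma>, c - {a}) (Some (snd a))"
      using c k aI idx_states[OF q] by (auto simp: lin_trans_Some)
    then show ?thesis by blast
  qed
qed

lemma lin_trans_lower:
  assumes "q \<in> states A" "lin_trans A (comp q) k (Some q) (\<sigma>, C) p" "a \<in> C"
  shows "a \<in> set_pbf (delta A q \<sigma>)" "snd a \<in> states A" "idx (snd a) < idx q"
proof -
  show "a \<in> set_pbf (delta A q \<sigma>)"
    using assms clauses_subset by (fastforce simp: lin_trans_Some split: option.splits)
  then show "snd a \<in> states A" "idx (snd a) < idx q"
    using delta_states[OF assms(1), of a \<sigma>] assms mem_comp[OF assms(1)]
    by (auto simp: lin_trans_Some le_less)
qed

lemma sem_upto_stable:
  assumes "q \<in> states A" "idx q < i" "i \<le> length comps"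
  shows "sem_upto A comps t i q = sem_upto A comps t (Suc (idx q)) q"
  using assms(2,3)
proof (induction i)
  case (Suc i)
  show ?case
  proof (cases "idx q = i")
    case False
    then have "q \<notin> fst (comps ! i)" using idx_eq Suc.prems by auto
    then show ?thesis using Suc False by (simp add: fun_eq_iff)
  qed simp
qed simp

lemma sem_eq_upto:
  assumes "q \<in> states A" "idx q < i" "i \<le> length comps"
  shows "sem A comps t q = sem_upto A comps t i q"
  using sem_upto_stable[OF assms] sem_upto_stable[OF assms(1), of "length comps"]
    idx_states[OF assms(1)] by (simp add: sem_def)

lemma sem_transient:
  assumes q: "q \<in> states A" and "knd q = Transient"
  shows "sem A comps t q v \<longleftrightarrow> sat_pbf (hold_atom t v (sem A comps t)) (delta A q (snd t v))"
proof -
  have "sem A comps t q v = sem_upto A comps t (Suc (idx q)) q v"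
    using sem_eq_upto[OF q, of "Suc (idx q)"] idx_states[OF q] by simp
  also have "\<dots> = sat_pbf (hold_atom t v (sem_upto A comps t (idx q))) (delta A q (snd t v))"
    using assms idx_states[OF q] by simp
  also have "\<dots> = sat_pbf (hold_atom t v (sem A comps t)) (delta A q (snd t v))"
    using transient_less[OF assms] delta_states[OF q] idx_states[OF q]
    by (intro sat_pbf_cong hold_atom_cong) (simp add: sem_eq_upto[of _ "idx q"])
  finally show ?thesis .
qed

lemma exit_in_sem_upto:
  assumes q: "q \<in> states A"
  shows "exit_in A (comp q) k t (sem_upto A comps t (idx q)) n q v =
    exit_in A (comp q) k t (sem A comps t) n q v"
proof (rule exit_in_cong)
  fix q' \<sigma> a w
  assume "q' \<in> comp q" "a \<in> set_pbf (delta A q' \<sigma>)" "snd a \<notin> comp q"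
  then have "snd a \<in> states A" "idx (snd a) < idx q"
    using mem_comp[OF q] delta_states[of q' a \<sigma>] by (auto simp: le_less)
  then show "sem_upto A comps t (idx q) (snd a) w = sem A comps t (snd a) w"
    using sem_eq_upto[of "snd a" "idx q"] idx_states[OF q] by simp
qed (use idx_states[OF q] in simp)

abbreviation exits :: "'ap tree \<Rightarrow> nat \<Rightarrow> 'q \<Rightarrow> nat list \<Rightarrow> bool" where
  "exits t n q v \<equiv> exit_in A (comp q) (knd q) t (sem A comps t) n q v"

text \<open>Reaching the exit means acceptance in an existential and rejection in a universal
  component; the inner equivalence covers both.\<close>

lemma sem_nontransient:
  assumes q: "q \<in> states A" and "knd q \<noteq> Transient"
  shows "sem A comps t q v \<longleftrightarrow> (knd q = Existential \<longleftrightarrow> (\<exists>n. exits t n q v))"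
proof -
  have "sem A comps t q v = sem_upto A comps t (Suc (idx q)) q v"
    using sem_eq_upto[OF q, of "Suc (idx q)"] idx_states[OF q] by simp
  also have "\<dots> \<longleftrightarrow> (knd q = Existential \<longleftrightarrow> (\<exists>n. exits t n q v))"
    using assms idx_states[OF q] by (cases "knd q") (auto simp: exit_in_sem_upto[OF q])
  finally show ?thesis .
qed

lemma exits_Suc:
  assumes q: "q \<in> states A"
  shows "exits t (Suc n) q v \<longleftrightarrow> (\<exists>C p. lin_trans A (comp q) (knd q) (Some q) (snd t v, C) p \<and>
     annot_ok (knd q) (hold_atom t v (sem A comps t)) C \<and>
     (case p of None \<Rightarrow> True | Some q' \<Rightarrow> \<exists>w\<in>children (fst t) v. exits t n q' w))"
proof -
  have "(case p of None \<Rightarrow> True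
        | Some q' \<Rightarrow> \<exists>w\<in>children (fst t) v. exit_in A (comp q) (knd q) t (sem A comps t) n q' w) =
      (case p of None \<Rightarrow> True | Some q' \<Rightarrow> \<exists>w\<in>children (fst t) v. exits t n q' w)"
    if "lin_trans A (comp q) (knd q) (Some q) (snd t v, C) p" for C p
    using that mem_comp[OF q] by (cases p) (simp_all add: lin_trans_Some)
  then show ?thesis unfolding exit_in.simps by (intro ex_cong1 conj_cong refl)
qed

lemma lin_trans_target:
  "q \<in> states A \<Longrightarrow> lin_trans A (comp q) k (Some q) (\<sigma>, C) (Some q') \<Longrightarrow> q' \<in> states A \<and> idx q' = idx q"
  using mem_comp by (auto simp: lin_trans_Some)

end

section \<open>Adequacy of the semantics\<close>

text \<open>Acceptance and \<open>SE\<close> quantify over paths from the root. A path starting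
  further down is completed by the prefixes of the address \<open>\<rho> 0\<close>. This serves runs
  as well as trees.\<close>

lemma path_extend:
  assumes D: "prefix_closed D" and "\<rho> 0 \<in> D" "\<And>i. \<rho> (Suc i) \<in> children D (\<rho> i)"
  obtains \<pi> where "\<pi> 0 = []" "\<And>i. \<pi> (Suc i) \<in> children D (\<pi> i)" "\<And>j. \<pi> (length (\<rho> 0) + j) = \<rho> j"
proof -
  let ?x = "\<rho> 0"
  define \<pi> where "\<pi> i = (if i < length ?x then take i ?x else \<rho> (i - length ?x))" for i
  have pre: "u @ w \<in> D \<Longrightarrow> u \<in> D" for u w
  proof (induction w rule: rev_induct)
    case (snoc i w)
    then show ?case using D unfolding prefix_closed_def by (metis append_assoc)
  qed simp
  have "\<pi> (Suc i) \<in> children D (\<pi> i)" for i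
  proof (cases "i < length ?x")
    case True
    then have "\<pi> (Suc i) = take (Suc i) ?x" by (auto simp: \<pi>_def)
    moreover have "take (Suc i) ?x = \<pi> i @ [?x ! i]"
      using True by (simp add: \<pi>_def take_Suc_conv_app_nth)
    moreover have "take (Suc i) ?x \<in> D"
      using pre[of "take (Suc i) ?x" "drop (Suc i) ?x"] assms(2) by simp
    ultimately show ?thesis by (auto simp: children_def)
  next
    case False
    then show ?thesis using assms(3)[of "i - length ?x"] by (simp add: \<pi>_def Suc_diff_le)
  qed
  then show thesis by (intro that[of \<pi>]) (simp_all add: \<pi>_def)
qed

text \<open>Addresses are lists of naturals, whence countability. \<open>from_nat_into\<close> may
  enumerate with repetition, so a node has either no children or one for each natural; repeated
  labels do no harm, since a run is only asked for the existence of labelled children.\<close>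

lemma unfold_graph:
  fixes succ :: "'l \<Rightarrow> 'l set"
  assumes "\<And>l. countable (succ l)"
  obtains Dr r where "[] \<in> Dr" "prefix_closed Dr" "r [] = l0"
    "\<And>x. x \<in> Dr \<Longrightarrow> r ` children Dr x = succ (r x)"
proof -
  define r where "r = foldl (\<lambda>l i. from_nat_into (succ l) i) l0"
  define Dr where "Dr = {x. \<forall>y i z. x = y @ i # z \<longrightarrow> succ (r y) \<noteq> {}}"
  have split: "x @ [i] = y @ j # z \<longleftrightarrow> z = [] \<and> y = x \<and> j = i \<or> (\<exists>z'. z = z' @ [i] \<and> x = y @ j # z')"
    for x y z :: "nat list" and i j
    by (cases z rule: rev_cases) auto
  have Dr: "x @ [i] \<in> Dr \<longleftrightarrow> x \<in> Dr \<and> succ (r x) \<noteq> {}" for x i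
    unfolding Dr_def mem_Collect_eq split by (metis (no_types, lifting))
  have "r ` children Dr x = succ (r x)" if "x \<in> Dr" for x
  proof -
    have "children Dr x = (if succ (r x) = {} then {} else range (\<lambda>i. x @ [i]))"
      using that by (auto simp: children_def Dr)
    moreover have "r (x @ [i]) = from_nat_into (succ (r x)) i" for i by (simp add: r_def)
    ultimately show ?thesis
      using range_from_nat_into[OF _ assms] by (auto simp: image_image)
  qed
  then show thesis using Dr by (intro that[of Dr r]) (auto simp: prefix_closed_def Dr_def r_def)
qed

lemma hold_atom_map: "hold_atom t v P (m, f q) = hold_atom t v (\<lambda>q. P (f q)) (m, q)"
  by (cases m) auto

lemma countable_children: "countable (children D v)"
  by (rule countableI_type)

section \<open>Accepting runs versus the semantics\<close>

context hesitant_aut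
begin

text \<open>Polarisation enters here: a path that stays in an existential component for ever is
  rejecting, one that stays in a universal component is accepting.\<close>

lemma knd_acc:
  assumes "q \<in> states A"
  shows "knd q = Existential \<Longrightarrow> q \<notin> acc A" "knd q = Universal \<Longrightarrow> q \<in> acc A"
proof -
  have "(comp q, knd q) \<in> set comps" using idx_states[OF assms] by simp
  then show "knd q = Existential \<Longrightarrow> q \<notin> acc A" "knd q = Universal \<Longrightarrow> q \<in> acc A"
    using pol idx_states[OF assms] unfolding polarised_def by blast+
qed

text \<open>Stated for a set \<open>X\<close> of nodes that need not be a tree, so that the part of
  a run inside an embedded copy of the automaton can be used for it.\<close>

lemma run_imp_sem:
  assumes run: "\<And>x. x \<in> X \<Longrightarrow> fst (r x) \<in> states A \<and>
      sat_pbf (sat_atom t X r x) (delta A (fst (r x)) (snd t (snd (r x))))"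
    and acc: "\<And>\<rho>. (\<And>i. \<rho> i \<in> X \<and> \<rho> (Suc i) \<in> children X (\<rho> i)) \<Longrightarrow> \<exists>\<^sub>\<infinity>i. fst (r (\<rho> i)) \<in> acc A"
    and "x \<in> X"
  shows "sem A comps t (fst (r x)) (snd (r x))"
  using \<open>x \<in> X\<close>
proof (induction "idx (fst (r x))" arbitrary: x rule: less_induct)
  case (less x)
  let ?q = "fst (r x)" and ?Z = "sem A comps t"
  have q: "?q \<in> states A" using run less.prems by blast
  have lower: "hold_atom t (snd (r y)) ?Z a"
    if "sat_atom t X r y a" "idx (snd a) < idx ?q" for y a
    using that(1) unfolding sat_atom_eq
  proof (rule hold_atom_mono)
    fix w assume "\<exists>z\<in>children X y. r z = (snd a, w)"
    then obtain z where "z \<in> X" "r z = (snd a, w)" by (auto simp: children_def)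
    then show "?Z (snd a) w" using less.hyps[of z] that(2) by simp
  qed
  show ?case
  proof (cases "knd ?q")
    case Transient
    show ?thesis unfolding sem_transient[OF q Transient]
      using run[OF less.prems] transient_less[OF q Transient] lower by (blast intro: sat_pbf_mono)
  next
    case Existential
    show ?thesis
    proof (rule ccontr)
      assume neg: "\<not> ?thesis"
      \<comment> \<open>Failure of the semantics is inherited along the move that the run makes
        within the component, which gives an infinite path there that never visits
        \<open>acc A\<close>.\<close>
      define bad where "bad y \<longleftrightarrow> y \<in> X \<and> idx (fst (r y)) = idx ?q \<and> \<not> ?Z (fst (r y)) (snd (r y))" for y
      have step: "\<exists>z. z \<in> children X y \<and> bad z" if y: "bad y" for y
      proof -
        let ?p = "fst (r y)"
        have yX: "y \<in> X" and p: "?p \<in> states A" and i: "idx ?p = idx ?q" and nZ: "\<not> ?Z ?p (snd (r y))"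
          using y run by (auto simp: bad_def)
        have k: "knd ?p = Existential" using i Existential by simp
        have ne: "\<not> exits t n ?p (snd (r y))" for n using nZ sem_nontransient[OF p] k by auto
        obtain c where c: "c \<in> clauses (knd ?p) (delta A ?p (snd t (snd (r y))))" "\<forall>a\<in>c. sat_atom t X r y a"
          using run[OF yX] k unfolding sat_pbf_dnf clauses_def by auto
        have ok: "annot_ok (knd ?p) (hold_atom t (snd (r y)) ?Z) C"
          if "lin_trans A (comp ?p) (knd ?p) (Some ?p) (snd t (snd (r y)), C) o'" "C \<subseteq> c" for C o'
          using lin_trans_lower[OF p that(1)] lower c(2) that(2) i k unfolding annot_ok_def by auto
        have "knd ?p \<noteq> Transient" using k by simp
        from clause_split[OF p this c(1)] show ?thesis
        proof (elim disjE exE conjE)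
          assume l: "lin_trans A (comp ?p) (knd ?p) (Some ?p) (snd t (snd (r y)), c) None"
          then have "exits t (Suc 0) ?p (snd (r y))" unfolding exits_Suc[OF p]
            using ok[OF l] by fastforce
          then show ?thesis using ne by blast
        next
          fix C q'
          assume ceq: "c = insert (step_mod (knd ?p), q') C"
            and l: "lin_trans A (comp ?p) (knd ?p) (Some ?p) (snd t (snd (r y)), C) (Some q')"
          have "sat_atom t X r y (Dia (Suc 0), q')" using c(2) ceq k by (simp add: step_mod_def)
          then obtain z w where z: "z \<in> children X y" "r z = (q', w)" "w \<in> children (fst t) (snd (r y))"
            unfolding sat_atom_eq hold_atom_Dia1 by blast
          have q': "q' \<in> states A" "idx q' = idx ?q" using lin_trans_target[OF p l] i by auto
          have "\<not> exits t n q' w" for n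
          proof
            assume "exits t n q' w"
            then have "exits t (Suc n) ?p (snd (r y))" unfolding exits_Suc[OF p]
              using l ok[OF l] ceq z(3) by fastforce
            then show False using ne by blast
          qed
          then have "\<not> ?Z q' w" using sem_nontransient[OF q'(1)] q'(2) Existential by simp
          then show ?thesis using z q' by (auto simp: bad_def children_def)
        qed
      qed
      define \<rho> where "\<rho> = rec_nat x (\<lambda>_ y. SOME z. z \<in> children X y \<and> bad z)"
      have \<rho>: "bad (\<rho> i)" for i
      proof (induction i)
        case 0
        then show ?case using neg less.prems by (simp add: \<rho>_def bad_def)
      next
        case (Suc i)
        then show ?case using someI_ex[OF step[OF Suc]] by (simp add: \<rho>_def)
      qed
      have "\<rho> (Suc i) \<in> children X (\<rho> i)" for i
        using someI_ex[OF step[OF \<rho>[of i]]] by (simp add: \<rho>_def)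
      then have "\<exists>\<^sub>\<infinity>i. fst (r (\<rho> i)) \<in> acc A" using acc \<rho> bad_def by blast
      then obtain i where "fst (r (\<rho> i)) \<in> acc A" using INFM_EX by blast
      moreover have "fst (r (\<rho> i)) \<in> states A" "knd (fst (r (\<rho> i))) = Existential"
        using \<rho>[of i] run Existential by (auto simp: bad_def)
      ultimately show False using knd_acc by blast
    qed
  next
    case Universal
    \<comment> \<open>A refuting branch is followed down the run. The run satisfies some atom of the
      refuted clause; only the \<open>Box 1\<close> atom is left, so the run also visits the child
      where the refutation goes on, and the branch gets shorter.\<close>
    have "\<not> exits t n (fst (r y)) (snd (r y))" if "y \<in> X" "idx (fst (r y)) = idx ?q" for n y
      using that
    proof (induction n arbitrary: y)
      case (Suc n)
      let ?p = "fst (r y)"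
      have p: "?p \<in> states A" using run Suc.prems by blast
      have k: "knd ?p = Universal" using Suc.prems Universal by simp
      show ?case
      proof
        assume "exits t (Suc n) ?p (snd (r y))"
        then obtain C o' where l: "lin_trans A (comp ?p) (knd ?p) (Some ?p) (snd t (snd (r y)), C) o'"
          and ok: "annot_ok (knd ?p) (hold_atom t (snd (r y)) ?Z) C"
          and o': "case o' of None \<Rightarrow> True | Some q' \<Rightarrow> \<exists>w\<in>children (fst t) (snd (r y)). exits t n q' w"
          unfolding exits_Suc[OF p] by blast
        have nC: "\<not> sat_atom t X r y a" if "a \<in> C" for a
          using lin_trans_lower[OF p l that] lower[of y a] ok k that Suc.prems unfolding annot_ok_def by auto
        have sat: "\<forall>c\<in>clauses (knd ?p) (delta A ?p (snd t (snd (r y)))). \<exists>a\<in>c. sat_atom t X r y a"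
          using run[OF Suc.prems(1)] k unfolding sat_pbf_cnf clauses_def by auto
        show False
        proof (cases o')
          case None
          then show ?thesis using l sat nC by (auto simp: lin_trans_Some)
        next
          case (Some q')
          then have "insert (step_mod (knd ?p), q') C \<in> clauses (knd ?p) (delta A ?p (snd t (snd (r y))))"
            using l by (simp add: lin_trans_Some)
          then have "sat_atom t X r y (step_mod (knd ?p), q')" using sat nC by fast
          then have "sat_atom t X r y (Box (Suc 0), q')" using k by (simp add: step_mod_def)
          moreover obtain w where w: "w \<in> children (fst t) (snd (r y))" "exits t n q' w"
            using o' Some by auto
          ultimately obtain z where z: "z \<in> children X y" "r z = (q', w)"
            unfolding sat_atom_eq hold_atom_Box1 by blast
          have "idx q' = idx ?q" using lin_trans_target[OF p l[unfolded Some]] Suc.prems by simp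
          then have "\<not> exits t n q' w" using Suc.IH[of z] z by (simp add: children_def)
          then show ?thesis using w(2) ..
        qed
      qed
    qed simp
    then show ?thesis using sem_nontransient[OF q] Universal less.prems by simp
  qed
qed

text \<open>Along an infinite sequence of descending pairs the component index stabilises, and the rank
  rules out that it does so in an existential component.\<close>

definition rank :: "'ap tree \<Rightarrow> 'q \<Rightarrow> nat list \<Rightarrow> nat" where
  "rank t q v = (LEAST n. exits t n q v)"

definition descends :: "'ap tree \<Rightarrow> 'q \<Rightarrow> nat list \<Rightarrow> 'q \<Rightarrow> nat list \<Rightarrow> bool" where
  "descends t q v q' v' \<longleftrightarrow> idx q' < idx q \<or> idx q' = idx q \<and>
     (knd q = Universal \<or> knd q = Existential \<and> rank t q' v' < rank t q v)"

text \<open>The local strategy from which accepting runs are unfolded. An existential state follows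
  a shortest branch to the exit, so the rank drops; at a universal state, a CNF clause without a
  good atom would be a transition prolonging a refutation.\<close>

lemma sem_imp_descends:
  assumes q: "q \<in> states A" and s: "sem A comps t q v"
  shows "sat_pbf (hold_atom t v (\<lambda>q' w. q' \<in> states A \<and> sem A comps t q' w \<and> descends t q v q' w))
    (delta A q (snd t v))" (is "sat_pbf (hold_atom t v ?P) _")
proof -
  let ?Z = "sem A comps t"
  have lower: "hold_atom t v ?P a \<longleftrightarrow> hold_atom t v ?Z a" if "snd a \<in> states A" "idx (snd a) < idx q" for a
    using that by (intro hold_atom_cong) (simp add: descends_def)
  show ?thesis
  proof (cases "knd q")
    case Transient
    then show ?thesis using s unfolding sem_transient[OF q Transient]
      using lower transient_less[OF q Transient] delta_states[OF q] by (blast intro: sat_pbf_mono)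
  next
    case Existential
    then have ex: "\<exists>n. exits t n q v" using s sem_nontransient[OF q] by simp
    then have "exits t (rank t q v) q v" unfolding rank_def by (rule LeastI_ex)
    then obtain n where n: "rank t q v = Suc n" "exits t (Suc n) q v"
      by (cases "rank t q v") auto
    then obtain C o' where l: "lin_trans A (comp q) (knd q) (Some q) (snd t v, C) o'"
      and ok: "annot_ok (knd q) (hold_atom t v ?Z) C"
      and o': "case o' of None \<Rightarrow> True | Some q' \<Rightarrow> \<exists>w\<in>children (fst t) v. exits t n q' w"
      unfolding exits_Suc[OF q] by blast
    have C: "hold_atom t v ?P a" if "a \<in> C" for a
      using lin_trans_lower[OF q l that] lower ok that Existential unfolding annot_ok_def by auto
    show ?thesis
    proof (cases o')
      case None
      then have "C \<in> dnf (delta A q (snd t v))" using l Existential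
        by (simp add: lin_trans_Some clauses_def)
      then show ?thesis using C unfolding sat_pbf_dnf by blast
    next
      case (Some q')
      then obtain w where w: "w \<in> children (fst t) v" "exits t n q' w" using o' by auto
      have q': "q' \<in> states A" "idx q' = idx q" using lin_trans_target[OF q l[unfolded Some]] by auto
      have "rank t q' w \<le> n" unfolding rank_def using w(2) by (rule Least_le)
      moreover have "?Z q' w" using sem_nontransient[OF q'(1)] q'(2) Existential w(2) by auto
      ultimately have "?P q' w" using q' n Existential by (simp add: descends_def)
      then have "hold_atom t v ?P (Dia (Suc 0), q')" unfolding hold_atom_Dia1 using w(1) by blast
      then show ?thesis using l C Existential Some unfolding sat_pbf_dnf
        by (intro bexI[of _ "insert (Dia (Suc 0), q') C"])
          (auto simp del: hold_atom.simps simp: lin_trans_Some clauses_def step_mod_def)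
    qed
  next
    case Universal
    then have nex: "\<not> exits t n q v" for n using s sem_nontransient[OF q] by simp
    show ?thesis unfolding sat_pbf_cnf
    proof (rule ballI, rule ccontr)
      fix c assume c: "c \<in> cnf (delta A q (snd t v))" and neg: "\<not> (\<exists>a\<in>c. hold_atom t v ?P a)"
      have c': "c \<in> clauses (knd q) (delta A q (snd t v))" using c Universal by (simp add: clauses_def)
      have ok: "annot_ok (knd q) (hold_atom t v ?Z) C"
        if "lin_trans A (comp q) (knd q) (Some q) (snd t v, C) o'" "C \<subseteq> c" for C o'
        unfolding annot_ok_def
      proof
        fix a assume a: "a \<in> C"
        then have "\<not> hold_atom t v ?P a" using neg that(2) by blast
        then show "hold_atom t v ?Z a = (knd q = Existential)"
          using lower[OF lin_trans_lower(2,3)[OF q that(1) a]] Universal by simp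
      qed
      have "knd q \<noteq> Transient" using Universal by simp
      from clause_split[OF q this c'] show False
      proof (elim disjE exE conjE)
        assume l: "lin_trans A (comp q) (knd q) (Some q) (snd t v, c) None"
        then have "exits t (Suc 0) q v" unfolding exits_Suc[OF q] using ok[OF l] by fastforce
        then show False using nex by blast
      next
        fix C q'
        assume ceq: "c = insert (step_mod (knd q), q') C"
          and l: "lin_trans A (comp q) (knd q) (Some q) (snd t v, C) (Some q')"
        have "\<not> hold_atom t v ?P (Box (Suc 0), q')"
          using neg ceq Universal by (simp add: step_mod_def del: hold_atom.simps)
        then obtain w where w: "w \<in> children (fst t) v" "\<not> ?P q' w" unfolding hold_atom_Box1 by blast
        have q': "q' \<in> states A" "idx q' = idx q" using lin_trans_target[OF q l] by auto
        then have "\<not> ?Z q' w" using w(2) Universal by (auto simp: descends_def)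
        then obtain n where "exits t n q' w" using sem_nontransient[OF q'(1)] q'(2) Universal by auto
        then have "exits t (Suc n) q v" unfolding exits_Suc[OF q]
          using l ok[OF l] ceq w(1) by fastforce
        then show False using nex by blast
      qed
    qed
  qed
qed

lemma descends_accepting:
  assumes st: "\<And>i. qs i \<in> states A" and d: "\<And>i. descends t (qs i) (vs i) (qs (Suc i)) (vs (Suc i))"
  shows "\<exists>\<^sub>\<infinity>i. qs i \<in> acc A"
proof -
  have mono: "idx (qs (Suc i)) \<le> idx (qs i)" for i using d[of i] by (auto simp: descends_def)
  obtain N where N: "\<And>i. idx (qs N) \<le> idx (qs i)"
    using ex_has_least_nat[of "\<lambda>i. True" 0 "\<lambda>i. idx (qs i)"] by auto
  have const: "idx (qs (N + i)) = idx (qs N)" for i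
    using lift_Suc_antimono_le[of "\<lambda>i. idx (qs i)", OF mono, of N "N + i"] N[of "N + i"] by simp
  have d': "knd (qs N) = Universal \<or> knd (qs N) = Existential \<and>
      rank t (qs (Suc (N + i))) (vs (Suc (N + i))) < rank t (qs (N + i)) (vs (N + i))" for i
    using d[of "N + i"] const[of i] const[of "Suc i"] by (auto simp: descends_def)
  have "knd (qs N) = Universal"
  proof (rule ccontr)
    assume "\<not> ?thesis"
    then have "(rank t (qs (N + Suc i)) (vs (N + Suc i)), rank t (qs (N + i)) (vs (N + i))) \<in> less_than" for i
      using d'[of i] by simp
    then show False
      using wf_no_infinite_down_chainE[OF wf_less_than, of "\<lambda>i. rank t (qs (N + i)) (vs (N + i))"] by blast
  qed
  then have "qs (N + i) \<in> acc A" for i using const[of i] knd_acc(2)[OF st[of "N + i"]] by simp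
  then show ?thesis unfolding INFM_nat_le by (metis le_add2)
qed

end

text \<open>Both \<open>A\<close> itself and \<open>theta_aut A \<theta>\<close> contain a copy of \<open>A\<close>, so adequacy is shown once for
  an automaton \<open>A'\<close> with an embedded copy of \<open>A\<close>.\<close>

locale embedding = hesitant_aut A comps
  for A :: "('ap, 'q) hta" and comps :: "('q set \<times> ckind) list" +
  fixes A' :: "('ap, 'p) hta" and f :: "'q \<Rightarrow> 'p"
  assumes inj: "inj f" and f_states: "q \<in> states A \<Longrightarrow> f q \<in> states A'"
    and f_delta: "q \<in> states A \<Longrightarrow> delta A' (f q) \<sigma> = map_pbf (\<lambda>(m, q'). (m, f q')) (delta A q \<sigma>)"
    and f_acc: "q \<in> states A \<Longrightarrow> f q \<in> acc A' \<longleftrightarrow> q \<in> acc A"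
begin

lemma f_sat:
  assumes "q \<in> states A"
  shows "sat_pbf (hold_atom t v P) (delta A' (f q) \<sigma>) \<longleftrightarrow>
    sat_pbf (hold_atom t v (\<lambda>q. P (f q))) (delta A q \<sigma>)"
proof -
  have "(hold_atom t v P \<circ> (\<lambda>(m, q'). (m, f q'))) = hold_atom t v (\<lambda>q. P (f q))"
    by (rule ext) (auto simp: hold_atom_map)
  then show ?thesis by (simp add: f_delta[OF assms] sat_pbf_map)
qed

text \<open>The nodes of the run labelled in the copy form the set \<open>X\<close>. A path inside
  \<open>X\<close> is completed to one from the root; the finite prefix does not affect which states
  recur.\<close>

lemma accepting_run_imp_sem:
  assumes run: "is_run A' t s Dr r" and acc: "accepting A' Dr r"
    and x: "x \<in> Dr" "r x = (f q, v)" "q \<in> states A"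
  shows "sem A comps t q v"
proof -
  define X where "X = {x \<in> Dr. fst (r x) \<in> f ` states A}"
  define r' where "r' x = (inv f (fst (r x)), snd (r x))" for x
  have r': "r' y = (p, w) \<longleftrightarrow> r y = (f p, w)" if "y \<in> X" for y p w
    using that inj by (cases "r y") (auto simp: X_def r'_def)
  have "sem A comps t (fst (r' x)) (snd (r' x))"
  proof (rule run_imp_sem[of X r'])
    show "x \<in> X" using x by (auto simp: X_def)
  next
    fix y assume y: "y \<in> X"
    then obtain p where p: "p \<in> states A" "fst (r y) = f p" by (auto simp: X_def)
    have r'y: "fst (r' y) = p" "snd (r' y) = snd (r y)" using p inj by (auto simp: r'_def)
    have "sat_pbf (hold_atom t (snd (r y)) (\<lambda>q w. \<exists>z\<in>children Dr y. r z = (q, w)))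
        (delta A' (f p) (snd t (snd (r y))))"
      using run y p by (auto simp: is_run_def X_def sat_atom_eq[abs_def])
    then have "sat_pbf (hold_atom t (snd (r y)) (\<lambda>q w. \<exists>z\<in>children Dr y. r z = (f q, w)))
        (delta A p (snd t (snd (r y))))" unfolding f_sat[OF p(1)] .
    then have "sat_pbf (sat_atom t X r' y) (delta A p (snd t (snd (r y))))"
    proof (rule sat_pbf_mono)
      fix a assume a: "a \<in> set_pbf (delta A p (snd t (snd (r y))))"
        and "hold_atom t (snd (r y)) (\<lambda>q w. \<exists>z\<in>children Dr y. r z = (f q, w)) a"
      from this(2) show "sat_atom t X r' y a" unfolding sat_atom_eq r'y(2)
      proof (rule hold_atom_mono)
        fix w assume "\<exists>z\<in>children Dr y. r z = (f (snd a), w)"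
        then obtain z where z: "z \<in> children Dr y" "r z = (f (snd a), w)" by blast
        then have "z \<in> children X y"
          using delta_states(1)[OF p(1) a] by (auto simp: X_def children_def)
        moreover from this have "z \<in> X" by (auto simp: children_def)
        ultimately show "\<exists>z\<in>children X y. r' z = (snd a, w)" using r' z by blast
      qed
    qed
    then show "fst (r' y) \<in> states A \<and>
        sat_pbf (sat_atom t X r' y) (delta A (fst (r' y)) (snd t (snd (r' y))))"
      using p r'y by simp
  next
    fix \<rho> assume \<rho>: "\<And>i. \<rho> i \<in> X \<and> \<rho> (Suc i) \<in> children X (\<rho> i)"
    have D: "prefix_closed Dr" "\<rho> 0 \<in> Dr" "\<And>i. \<rho> (Suc i) \<in> children Dr (\<rho> i)"
      using run \<rho> by (auto simp: is_run_def X_def children_def)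
    obtain \<pi> where \<pi>: "\<pi> 0 = []" "\<And>i. \<pi> (Suc i) \<in> children Dr (\<pi> i)" "\<And>j. \<pi> (length (\<rho> 0) + j) = \<rho> j"
      using path_extend[OF D] by blast
    then have inf: "\<exists>\<^sub>\<infinity>i. fst (r (\<pi> i)) \<in> acc A'" using acc by (simp add: accepting_def)
    have "\<exists>n\<ge>m. fst (r' (\<rho> n)) \<in> acc A" for m
    proof -
      obtain n where n: "n \<ge> length (\<rho> 0) + m" "fst (r (\<pi> n)) \<in> acc A'"
        using inf unfolding INFM_nat_le by blast
      then obtain j where j: "n = length (\<rho> 0) + j" "j \<ge> m" by (metis add_leD1 le_Suc_ex nat_add_left_cancel_le)
      obtain p where p: "p \<in> states A" "fst (r (\<rho> j)) = f p" using \<rho>[of j] by (auto simp: X_def)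
      then have "fst (r' (\<rho> j)) = p" using inj by (simp add: r'_def)
      then show ?thesis using j n p \<pi>(3) f_acc[OF p(1)] by auto
    qed
    then show "\<exists>\<^sub>\<infinity>i. fst (r' (\<rho> i)) \<in> acc A" unfolding INFM_nat_le by blast
  qed
  then show ?thesis using r'[of x q v] x by (auto simp: X_def)
qed

text \<open>For a label outside the copy, such as the fresh initial state of
  \<open>theta_aut\<close>, the last condition is vacuous and every accepted pair at a child is a
  successor.\<close>

definition succs :: "'ap tree \<Rightarrow> 'p \<times> nat list \<Rightarrow> ('p \<times> nat list) set" where
  "succs t l = {(f q', w) | q' w. w \<in> children (fst t) (snd l) \<and> q' \<in> states A \<and> sem A comps t q' w \<and>
     (\<forall>q\<in>states A. fst l = f q \<longrightarrow> descends t q (snd l) q' w)}"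

lemma sem_imp_accepting_run:
  assumes t: "wf_tree t" and init: "init A' \<in> states A'"
    and root: "sat_pbf (hold_atom t [] (\<lambda>p w. (p, w) \<in> succs t (init A', []))) (delta A' (init A') (snd t []))"
  shows "\<exists>Dr r. is_run A' t [] Dr r \<and> accepting A' Dr r"
proof -
  have fin: "finite (states A)" using wf by (simp add: hta_wf_def)
  have "countable (succs t l)" for l
  proof (rule countable_subset)
    show "succs t l \<subseteq> f ` states A \<times> children (fst t) (snd l)" by (auto simp: succs_def)
  qed (use fin countable_children countable_finite in blast)
  then obtain Dr r where Dr: "[] \<in> Dr" "prefix_closed Dr" "r [] = (init A', [])"
    "\<And>x. x \<in> Dr \<Longrightarrow> r ` children Dr x = succs t (r x)"
    using unfold_graph[of "succs t" "(init A', [])"] by blast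
  have child: "r y \<in> succs t (r x)" if "x \<in> Dr" "y \<in> children Dr x" for x y using Dr(4) that by blast
  have good: "fst (r x) \<in> states A' \<and> snd (r x) \<in> fst t \<and>
      sat_pbf (hold_atom t (snd (r x)) (\<lambda>p w. (p, w) \<in> succs t (r x))) (delta A' (fst (r x)) (snd t (snd (r x))))"
    if "x \<in> Dr" for x
  proof (cases x rule: rev_cases)
    case Nil
    then show ?thesis using Dr(3) init root t by (simp add: wf_tree_def)
  next
    case (snoc y i)
    have "y \<in> Dr" using Dr(2) that snoc by (auto simp: prefix_closed_def)
    moreover have "x \<in> children Dr y" using that snoc by (auto simp: children_def)
    ultimately have "r x \<in> succs t (r y)" using child by blast
    then obtain q' w where q': "r x = (f q', w)" "w \<in> children (fst t) (snd (r y))" "q' \<in> states A"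
      "sem A comps t q' w" by (auto simp: succs_def)
    have "sat_pbf (hold_atom t w (\<lambda>p u. (p, u) \<in> succs t (r x))) (delta A' (f q') (snd t w))"
      unfolding f_sat[OF q'(3)]
    proof (rule sat_pbf_mono[OF sem_imp_descends[OF q'(3,4)]])
      fix a :: "'q atom"
      assume "hold_atom t w (\<lambda>q'' u. q'' \<in> states A \<and> sem A comps t q'' u \<and> descends t q' w q'' u) a"
      then show "hold_atom t w (\<lambda>q u. (f q, u) \<in> succs t (r x)) a"
        by (rule hold_atom_mono) (use q' inj in \<open>auto simp: succs_def dest: injD\<close>)
    qed
    then show ?thesis using q' f_states by (auto simp: children_def)
  qed
  have "is_run A' t [] Dr r"
    unfolding is_run_def
  proof (intro conjI ballI)
    fix x assume x: "x \<in> Dr"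
    show "sat_pbf (sat_atom t Dr r x) (delta A' (fst (r x)) (snd t (snd (r x))))"
    proof (rule sat_pbf_mono)
      show "sat_pbf (hold_atom t (snd (r x)) (\<lambda>p w. (p, w) \<in> succs t (r x)))
          (delta A' (fst (r x)) (snd t (snd (r x))))" using good[OF x] by blast
      fix a assume "hold_atom t (snd (r x)) (\<lambda>p w. (p, w) \<in> succs t (r x)) a"
      then show "sat_atom t Dr r x a" unfolding sat_atom_eq
        by (rule hold_atom_mono) (use Dr(4)[OF x] in force)
    qed
  qed (use Dr good in auto)
  moreover have "accepting A' Dr r"
    unfolding accepting_def
  proof (intro allI impI)
    fix \<rho> assume \<rho>: "\<rho> 0 = [] \<and> (\<forall>i. \<rho> (Suc i) \<in> children Dr (\<rho> i))"
    have "\<rho> i \<in> Dr" for i using \<rho> Dr(1) by (cases i) (auto simp: children_def)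
    then have sc: "r (\<rho> (Suc i)) \<in> succs t (r (\<rho> i))" for i using child \<rho> by blast
    \<comment> \<open>The index is shifted by one because the state at the root may lie outside the
      copy.\<close>
    define qs where "qs i = inv f (fst (r (\<rho> (Suc i))))" for i
    define vs where "vs i = snd (r (\<rho> (Suc i)))" for i
    have qs: "qs i \<in> states A" "r (\<rho> (Suc i)) = (f (qs i), vs i)" for i
      using sc[of i] inj by (auto simp: succs_def qs_def vs_def)
    have "descends t (qs i) (vs i) (qs (Suc i)) (vs (Suc i))" for i
      using sc[of "Suc i"] qs[of i] qs[of "Suc i"] inj by (auto simp: succs_def dest: injD)
    then have "\<exists>\<^sub>\<infinity>i. qs i \<in> acc A" using descends_accepting qs(1) by blast
    then show "\<exists>\<^sub>\<infinity>i. fst (r (\<rho> i)) \<in> acc A'"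
      unfolding INFM_nat_le using qs f_acc by (metis fst_conv le_Suc_eq)
  qed
  ultimately show ?thesis by blast
qed

end

context hesitant_aut
begin

lemma hta_lang_iff: "t \<in> hta_lang A \<longleftrightarrow> wf_tree t \<and> sem A comps t (init A) []"
proof -
  interpret embedding A comps A id
    by unfold_locales (auto simp: pbf.map_id)
  have q: "init A \<in> states A" using wf by (simp add: hta_wf_def)
  have "sem A comps t (init A) []" if "is_run A t [] Dr r" "accepting A Dr r" for Dr r
    using accepting_run_imp_sem[OF that, of "[]"] that q by (auto simp: is_run_def)
  moreover have "\<exists>Dr r. is_run A t [] Dr r \<and> accepting A Dr r" if "wf_tree t" "sem A comps t (init A) []"
  proof (rule sem_imp_accepting_run[OF that(1) q])
    show "sat_pbf (hold_atom t [] (\<lambda>p w. (p, w) \<in> succs t (init A, []))) (delta A (init A) (snd t []))"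
    proof (rule sat_pbf_mono[OF sem_imp_descends[OF q that(2)]])
      fix a :: "'q atom"
      assume "hold_atom t [] (\<lambda>q' w. q' \<in> states A \<and> sem A comps t q' w \<and> descends t (init A) [] q' w) a"
      then show "hold_atom t [] (\<lambda>p w. (p, w) \<in> succs t (init A, [])) a"
        by (rule hold_atom_mono) (auto simp: succs_def)
    qed
  qed
  ultimately show ?thesis by (auto simp: hta_lang_def)
qed

lemma theta_aut_lang_iff:
  assumes t: "wf_tree t" and \<theta>: "snd \<theta> \<in> states A"
  shows "t \<in> hta_lang (theta_aut A \<theta>) \<longleftrightarrow> hold_atom t [] (sem A comps t) \<theta>"
proof -
  interpret embedding A comps "theta_aut A \<theta>" Some
    by unfold_locales (auto simp: theta_aut_def)
  obtain m q where mq: "\<theta> = (m, q)" by fastforce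
  have i: "init (theta_aut A \<theta>) = None" "None \<in> states (theta_aut A \<theta>)"
    "delta (theta_aut A \<theta>) None \<sigma> = BAtom (m, Some q)" for \<sigma>
    by (auto simp: theta_aut_def mq)
  have "hold_atom t [] (sem A comps t) \<theta>"
    if run: "is_run (theta_aut A \<theta>) t [] Dr r" "accepting (theta_aut A \<theta>) Dr r" for Dr r
  proof -
    have root: "[] \<in> Dr" "r [] = (None, [])" using run by (auto simp: is_run_def i)
    then have "sat_atom t Dr r [] (m, Some q)" using run i by (force simp: is_run_def)
    then have "hold_atom t [] (\<lambda>q w. \<exists>y\<in>children Dr []. r y = (Some q, w)) (m, q)"
      using root unfolding sat_atom_eq by (simp add: hold_atom_map)
    then show ?thesis unfolding mq
    proof (rule hold_atom_mono)
      fix w assume "\<exists>y\<in>children Dr []. r y = (Some (snd (m, q)), w)"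
      then show "sem A comps t (snd (m, q)) w"
        using accepting_run_imp_sem[OF run] \<theta> mq by (auto simp: children_def)
    qed
  qed
  moreover have "\<exists>Dr r. is_run (theta_aut A \<theta>) t [] Dr r \<and> accepting (theta_aut A \<theta>) Dr r"
    if h: "hold_atom t [] (sem A comps t) \<theta>"
  proof (rule sem_imp_accepting_run[OF t])
    have "hold_atom t [] (\<lambda>q w. (Some q, w) \<in> succs t (None, [])) (m, q)"
      using h unfolding mq by (rule hold_atom_mono) (use \<theta> mq in \<open>auto simp: succs_def\<close>)
    then show "sat_pbf (hold_atom t [] (\<lambda>p w. (p, w) \<in> succs t (init (theta_aut A \<theta>), [])))
        (delta (theta_aut A \<theta>) (init (theta_aut A \<theta>)) (snd t []))"
      by (simp add: i hold_atom_map)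
  qed (simp add: i)
  ultimately show ?thesis using t by (auto simp: hta_lang_def)
qed

end

section \<open>Visibility and counter-freeness\<close>

text \<open>Visibility compares languages and so concerns only roots; subtrees carry it over to
  inner nodes.\<close>

definition subtree :: "'ap tree \<Rightarrow> nat list \<Rightarrow> 'ap tree" where
  "subtree t v = ({w. v @ w \<in> fst t}, \<lambda>w. snd t (v @ w))"

lemma children_subtree: "children (fst t) (v @ w) = (@) v ` children (fst (subtree t v)) w"
  by (auto simp: children_def subtree_def)

lemma wf_subtree:
  assumes "wf_tree t" "v \<in> fst t"
  shows "wf_tree (subtree t v)"
proof -
  have "finite (children (fst (subtree t v)) w) \<and> children (fst (subtree t v)) w \<noteq> {}"
    if "v @ w \<in> fst t" for w
    using assms that children_subtree[of t v w] unfolding wf_tree_def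
    by (metis finite_imageD image_empty inj_onI same_append_eq)
  then show ?thesis using assms unfolding wf_tree_def prefix_closed_def
    by (auto simp: subtree_def)
qed

lemma hold_atom_subtree:
  "hold_atom (subtree t v) w (\<lambda>q x. P q (v @ x)) a = hold_atom t (v @ w) P a"
proof -
  have inj: "inj_on ((@) v) X" for X by (simp add: inj_on_def)
  have ex: "(\<exists>S. S \<subseteq> (@) v ` X \<and> R S) \<longleftrightarrow> (\<exists>S. S \<subseteq> X \<and> R ((@) v ` S))" for X R
    by (auto simp: subset_image_iff)
  have diff: "(@) v ` X - (@) v ` S = (@) v ` (X - S)" for X S by auto
  show ?thesis
    by (cases "(t, v @ w, P, a)" rule: hold_atom.cases)
      (simp_all add: children_subtree ex diff finite_image_iff[OF inj] card_image[OF inj])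
qed

lemma exit_in_subtree:
  "exit_in A Qi k (subtree t v) (\<lambda>q x. Z q (v @ x)) n q w = exit_in A Qi k t Z n q (v @ w)"
proof (induction n arbitrary: q w)
  case (Suc n)
  have "snd (subtree t v) w = snd t (v @ w)" by (simp add: subtree_def)
  then show ?case
    by (auto simp: hold_atom_subtree[abs_def] children_subtree Suc annot_ok_def split: option.splits)
qed simp

lemma sem_upto_subtree:
  "sem_upto A comps (subtree t v) i = (\<lambda>q w. sem_upto A comps t i q (v @ w))"
proof (induction i)
  case (Suc i)
  have "snd (subtree t v) w = snd t (v @ w)" for w by (simp add: subtree_def)
  moreover have "hold_atom (subtree t v) w (\<lambda>q x. sem_upto A comps t i q (v @ x)) =
      hold_atom t (v @ w) (sem_upto A comps t i)" for w
    by (rule ext) (rule hold_atom_subtree)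
  ultimately show ?case unfolding sem_upto.simps Suc
    by (simp add: exit_in_subtree cong: if_cong ckind.case_cong)
qed simp

lemma (in hesitant_aut) annots_states:
  assumes "q \<in> states A" "C \<in> annots A (comp q) k" "a \<in> C"
  shows "snd a \<in> states A" "idx (snd a) < idx q"
proof -
  obtain q' \<sigma> p where q': "q' \<in> comp q" "lin_trans A (comp q) k (Some q') (\<sigma>, C) p"
    using assms by (auto simp: annots_def)
  then have "q' \<in> states A" "idx q' = idx q" using mem_comp[OF assms(1)] by auto
  then show "snd a \<in> states A" "idx (snd a) < idx q"
    using lin_trans_lower[of q' k \<sigma> C p a] q' assms(3) by auto
qed

text \<open>At any node exactly one of the complementary atoms \<open>\<theta>\<close> and
  \<open>\<theta>'\<close> holds, whereas \<open>annot_ok\<close> gives all atoms of both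
  annotations the same truth value, true or false according to the kind.\<close>

lemma (in hesitant_aut) visible_annot_unique:
  assumes vis: "visible A comps" and t: "wf_tree t" "v \<in> fst t"
    and q: "q \<in> states A" "knd q \<noteq> Transient"
    and C: "C \<in> annots A (comp q) (knd q)" "annot_ok (knd q) (hold_atom t v (sem A comps t)) C"
    and C': "C' \<in> annots A (comp q) (knd q)" "annot_ok (knd q) (hold_atom t v (sem A comps t)) C'"
  shows "C = C'"
proof (rule ccontr)
  assume "C \<noteq> C'"
  have "(comp q, knd q) \<in> set comps" using idx_states[OF q(1)] by simp
  with vis q(2) have "\<forall>C\<in>annots A (comp q) (knd q). \<forall>C'\<in>annots A (comp q) (knd q). C \<noteq> C' \<longrightarrow>
      (\<exists>\<theta>\<in>C. \<exists>\<theta>'\<in>C'. hta_lang (theta_aut A \<theta>) = {t. wf_tree t} - hta_lang (theta_aut A \<theta>'))"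
    unfolding visible_def by fast
  then obtain \<theta> \<theta>' where \<theta>: "\<theta> \<in> C" "\<theta>' \<in> C'"
    "hta_lang (theta_aut A \<theta>) = {t. wf_tree t} - hta_lang (theta_aut A \<theta>')"
    using C(1) C'(1) \<open>C \<noteq> C'\<close> by meson
  have st: "snd \<theta> \<in> states A" "snd \<theta>' \<in> states A"
    using annots_states(1)[OF q(1)] C(1) C'(1) \<theta> by blast+
  have sub: "subtree t v \<in> hta_lang (theta_aut A \<xi>) \<longleftrightarrow> hold_atom t v (sem A comps t) \<xi>"
    if "snd \<xi> \<in> states A" for \<xi>
    using theta_aut_lang_iff[OF wf_subtree[OF t] that] hold_atom_subtree[of t v "[]" "sem A comps t" \<xi>]
    by (simp add: sem_def sem_upto_subtree)
  have "hold_atom t v (sem A comps t) \<theta> \<longleftrightarrow> \<not> hold_atom t v (sem A comps t) \<theta>'"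
    using sub[OF st(1)] sub[OF st(2)] \<theta>(3) wf_subtree[OF t] by blast
  then show False using C(2) C'(2) \<theta> unfolding annot_ok_def by blast
qed

text \<open>A path of length at least \<open>card S\<close> repeats a state; by the hypothesis that state has a loop,
  which prolongs the path by one. Hence the powers of \<open>R\<close> eventually increase.\<close>

lemma relpow_stabilises:
  assumes S: "finite S" "R \<subseteq> S \<times> S"
    and cf: "\<And>p n. n > 0 \<Longrightarrow> (p, p) \<in> R ^^ n \<Longrightarrow> (p, p) \<in> R"
  shows "\<exists>n>0. R ^^ Suc n = R ^^ n"
proof -
  \<comment> \<open>Only positive exponents: \<open>R ^^ 0\<close> is the identity on the whole
    type.\<close>
  have sub: "R ^^ n \<subseteq> S \<times> S" if n: "n > 0" for n
  proof -
    obtain m where "n = Suc m" using n by (cases n) auto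
    then show ?thesis using S(2) relpow_Suc_D2[of _ _ m R] by fastforce
  qed
  have grow: "R ^^ n \<subseteq> R ^^ Suc n" if n: "n \<ge> card S" "n > 0" for n
  proof
    fix x assume "x \<in> R ^^ n"
    then obtain p q where x: "x = (p, q)" "(p, q) \<in> R ^^ n" by (cases x) auto
    then obtain f where f: "f 0 = p" "f n = q" "\<And>i. i < n \<Longrightarrow> (f i, f (Suc i)) \<in> R"
      unfolding relpow_fun_conv by blast
    have "f i \<in> S" if "i \<le> n" for i
    proof (cases i)
      case 0
      then show ?thesis using f(3)[of 0] S(2) n(2) by auto
    next
      case (Suc j)
      then show ?thesis using f(3)[of j] S(2) that by auto
    qed
    then have "f ` {..n} \<subseteq> S" by auto
    then have "card (f ` {..n}) < card {..n}"
      using card_mono[OF S(1), of "f ` {..n}"] n(1) by simp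
    then have "\<not> inj_on f {..n}" by (rule pigeonhole)
    then obtain i j where ij: "i < j" "j \<le> n" "f i = f j"
      unfolding inj_on_def by (metis atMost_iff nat_neq_iff)
    have seg: "(f a, f (a + d)) \<in> R ^^ d" if "a + d \<le> n" for a d
      unfolding relpow_fun_conv using f(3) that by (intro exI[of _ "\<lambda>l. f (a + l)"]) auto
    have "(f i, f i) \<in> R ^^ (j - i)" using seg[of i "j - i"] ij by simp
    then have "(f i, f i) \<in> R" using cf[of "j - i"] ij by simp
    then have "(f 0, f i) \<in> R ^^ Suc i" using seg[of 0 i] ij by auto
    moreover have "(f i, f n) \<in> R ^^ (n - i)" using seg[of i "n - i"] ij by simp
    ultimately have "(p, q) \<in> R ^^ Suc i O R ^^ (n - i)" using f by auto
    then show "x \<in> R ^^ Suc n" using x ij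
      by (simp only: relpow_add[symmetric]) (simp del: relpow.simps)
  qed
  show ?thesis
  proof (rule ccontr)
    assume neg: "\<not> ?thesis"
    \<comment> \<open>If no two consecutive powers agreed, growth from \<open>?N\<close> on would be
      strict and exceed the bound \<open>card (S \<times> S)\<close>.\<close>
    let ?N = "Suc (card S)"
    have "i \<le> card (R ^^ (?N + i))" for i
    proof (induction i)
      case (Suc i)
      have "R ^^ (?N + i) \<subset> R ^^ (?N + Suc i)" using grow[of "?N + i"] neg
        by (metis add_Suc_right le_add1 less_add_Suc1 order_less_imp_le psubsetI zero_less_Suc plus_nat.simps(2))
      moreover have "finite (R ^^ (?N + Suc i))"
        using sub[of "?N + Suc i"] S(1) finite_subset by blast
      ultimately have "card (R ^^ (?N + i)) < card (R ^^ (?N + Suc i))" by (rule psubset_card_mono[rotated])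
      then show ?case using Suc by linarith
    qed simp
    from this[of "Suc (card (S \<times> S))"] show False
      using card_mono[OF _ sub[of "?N + Suc (card (S \<times> S))"]] S(1) by simp
  qed
qed

text \<open>The restriction on the source keeps even the relation of the empty word, and hence the
  whole transition monoid, inside a finite set.\<close>

definition lin_rel :: "('ap, 'q) hta \<Rightarrow> 'q set \<Rightarrow> ckind \<Rightarrow> ('ap set \<times> 'q atom set) list \<Rightarrow> 'q option rel" where
  "lin_rel A Qi k w = {(p, p'). p \<in> insert None (Some ` Qi) \<and> lin_path A Qi k p w p'}"

lemma lin_path_append:
  "lin_path A Qi k p (u @ w) p' \<longleftrightarrow> (\<exists>p''. lin_path A Qi k p u p'' \<and> lin_path A Qi k p'' w p')"
  by (induction u arbitrary: p) auto

lemma lin_path_target: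
  "lin_path A Qi k p w p' \<Longrightarrow> p \<in> insert None (Some ` Qi) \<Longrightarrow> p' \<in> insert None (Some ` Qi)"
proof (induction w arbitrary: p)
  case (Cons a w)
  then obtain p'' where "lin_trans A Qi k p a p''" "lin_path A Qi k p'' w p'" by auto
  moreover from this have "p'' \<in> insert None (Some ` Qi)" by (auto simp: lin_trans_def Let_def)
  ultimately show ?case using Cons.IH by blast
qed simp

lemma lin_rel_append: "lin_rel A Qi k (u @ w) = lin_rel A Qi k u O lin_rel A Qi k w"
  unfolding lin_rel_def lin_path_append using lin_path_target by fast

lemma lin_rel_Nil: "lin_rel A Qi k [] = Id_on (insert None (Some ` Qi))"
  by (auto simp: lin_rel_def)

lemma lin_rel_subset:
  "lin_rel A Qi k w \<subseteq> insert None (Some ` Qi) \<times> insert None (Some ` Qi)"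
  unfolding lin_rel_def using lin_path_target by fast

lemma lin_rel_single: "(Some q, p) \<in> lin_rel A Qi k [a] \<longleftrightarrow> lin_trans A Qi k (Some q) a p"
  by (cases a) (auto simp: lin_rel_def lin_trans_Some)

text \<open>For the relation of a word \<open>u\<close>, counter-freeness is the loop hypothesis of
  \<open>relpow_stabilises\<close>: a pair \<open>(p, p)\<close> in a positive power is already in
  the relation.\<close>

lemma aperiodic_monoid_lin_rel:
  assumes fin: "finite Qi" and cf: "counter_free_lin A Qi k"
  shows "aperiodic_monoid (lin_rel A Qi k ` lists L) (O) (lin_rel A Qi k [])"
proof
  let ?S = "insert None (Some ` Qi)" and ?rel = "lin_rel A Qi k"
  have "?rel ` lists L \<subseteq> Pow (?S \<times> ?S)" using lin_rel_subset by blast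
  then show "finite (?rel ` lists L)" by (rule finite_subset) (simp add: fin)
  show "?rel [] \<in> ?rel ` lists L" by simp
  show "x O y \<in> ?rel ` lists L" if xy: "x \<in> ?rel ` lists L" "y \<in> ?rel ` lists L" for x y
  proof -
    obtain u w where "x = ?rel u" "y = ?rel w" "u \<in> lists L" "w \<in> lists L" using xy by blast
    then have "x O y = ?rel (u @ w)" "u @ w \<in> lists L" by (simp_all add: lin_rel_append)
    then show ?thesis by blast
  qed
  show "(x O y) O z = x O (y O z)" for x y z by (rule O_assoc)
  show "?rel [] O x = x" if xL: "x \<in> ?rel ` lists L" for x
  proof -
    obtain u where "x = ?rel u" using xL by blast
    then show ?thesis using lin_rel_append[of A Qi k "[]" u] by simp
  qed
  show "x O ?rel [] = x" if xL: "x \<in> ?rel ` lists L" for x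
  proof -
    obtain u where "x = ?rel u" using xL by blast
    then show ?thesis using lin_rel_append[of A Qi k u "[]"] by simp
  qed
  show "\<exists>n. ((O) x ^^ Suc n) (?rel []) = ((O) x ^^ n) (?rel [])" if xL: "x \<in> ?rel ` lists L" for x
  proof -
    obtain u where u: "x = ?rel u" using xL by blast
    have pw: "((O) x ^^ n) (?rel []) = ?rel (concat (replicate n u))" for n
      by (induction n) (auto simp: u lin_rel_append)
    \<comment> \<open>Stated for positive powers, because the zeroth power of a relation and the
      monoid unit \<open>?rel []\<close> may differ.\<close>
    have rp: "?rel (concat (replicate (Suc n) u)) = ?rel u ^^ Suc n" for n
    proof (induction n)
      case 0
      then show ?case by simp
    next
      case (Suc n)
      have "?rel (concat (replicate (Suc (Suc n)) u)) = ?rel u O ?rel (concat (replicate (Suc n) u))"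
        by (simp add: lin_rel_append)
      also have "\<dots> = ?rel u ^^ Suc (Suc n)" using relpow_commute[of "?rel u" "Suc n"] unfolding Suc by simp
      finally show ?case .
    qed
    have "\<exists>n>0. ?rel u ^^ Suc n = ?rel u ^^ n"
    proof (rule relpow_stabilises[OF _ lin_rel_subset])
      fix p and n :: nat assume n: "n > 0" "(p, p) \<in> ?rel u ^^ n"
      then obtain m where "n = Suc m" by (cases n) auto
      then have "(p, p) \<in> ?rel (concat (replicate n u))" using n rp[of m] by simp
      then show "(p, p) \<in> ?rel u" using cf n(1) unfolding counter_free_lin_def lin_rel_def by blast
    qed (simp add: fin)
    then obtain n where "n > 0" "?rel u ^^ Suc n = ?rel u ^^ n" by blast
    then show ?thesis unfolding pw using rp by (metis gr0_implies_Suc)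
  qed
qed

section \<open>Definability in the branching-time logic\<close>

definition state_definable :: "('ap tree \<Rightarrow> nat list \<Rightarrow> bool) \<Rightarrow> bool" where
  "state_definable P \<longleftrightarrow> (\<exists>\<chi>. \<forall>t v. wf_tree t \<longrightarrow> v \<in> fst t \<longrightarrow> holds_s t v \<chi> = P t v)"

lemma state_definable_cong:
  assumes "state_definable P" "\<And>t v. wf_tree t \<Longrightarrow> v \<in> fst t \<Longrightarrow> P t v = P' t v"
  shows "state_definable P'"
  using assms unfolding state_definable_def by (metis (no_types))

lemma state_definable_Prop: "state_definable (\<lambda>t v. p \<in> snd t v)"
  unfolding state_definable_def by (rule exI[of _ "SProp p"]) simp

lemma state_definable_Not: "state_definable P \<Longrightarrow> state_definable (\<lambda>t v. \<not> P t v)"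
  unfolding state_definable_def by (metis holds_s.simps(2))

lemma state_definable_Or:
  assumes "state_definable P" "state_definable Q"
  shows "state_definable (\<lambda>t v. P t v \<or> Q t v)"
proof -
  obtain \<chi> \<chi>' where "\<forall>t v. wf_tree t \<longrightarrow> v \<in> fst t \<longrightarrow> holds_s t v \<chi> = P t v"
    "\<forall>t v. wf_tree t \<longrightarrow> v \<in> fst t \<longrightarrow> holds_s t v \<chi>' = Q t v"
    using assms unfolding state_definable_def by blast
  then show ?thesis unfolding state_definable_def by (intro exI[of _ "SOr \<chi> \<chi>'"]) simp
qed

lemma state_definable_And:
  assumes "state_definable P" "state_definable Q"
  shows "state_definable (\<lambda>t v. P t v \<and> Q t v)"
  using state_definable_Not[OF state_definable_Or[OF assms[THEN state_definable_Not]]] by simp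

text \<open>The syntax has no constants; excluded middle for an arbitrary proposition supplies
  truth.\<close>

lemma state_definable_True: "state_definable (\<lambda>t v. True)"
  using state_definable_Or[OF state_definable_Prop[of undefined]
    state_definable_Not[OF state_definable_Prop[of undefined]]] by simp

lemma state_definable_Ball:
  "finite I \<Longrightarrow> (\<And>i. i \<in> I \<Longrightarrow> state_definable (P i)) \<Longrightarrow> state_definable (\<lambda>t v. \<forall>i\<in>I. P i t v)"
  by (induction I rule: finite_induct) (auto intro: state_definable_True state_definable_And)

lemma state_definable_Bex:
  assumes "finite I" "\<And>i. i \<in> I \<Longrightarrow> state_definable (P i)"
  shows "state_definable (\<lambda>t v. \<exists>i\<in>I. P i t v)"
  using state_definable_Not[OF state_definable_Ball[OF assms(1), of "\<lambda>i t v. \<not> P i t v"]]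
    state_definable_Not[OF assms(2)] by simp

lemma state_definable_label: "state_definable (\<lambda>t v. snd t v = (\<sigma> :: 'ap::finite set))"
proof -
  have "state_definable (\<lambda>t v. p \<in> snd t v \<longleftrightarrow> p \<in> \<sigma>)" for p
    using state_definable_Prop[of p] state_definable_Not[OF state_definable_Prop[of p]]
    by (cases "p \<in> \<sigma>") simp_all
  then have "state_definable (\<lambda>t v. \<forall>p\<in>UNIV. p \<in> snd t v \<longleftrightarrow> p \<in> \<sigma>)"
    by (intro state_definable_Ball) simp_all
  then show ?thesis by (simp add: set_eq_iff)
qed

text \<open>Both sides compare \<open>k\<close> with the number of children that violate
  \<open>P\<close>, a finite number by finite branching.\<close>

lemma hold_atom_Box_iff:
  assumes "finite (children (fst t) v)"
  shows "hold_atom t v P (Box k, q) \<longleftrightarrow> \<not> hold_atom t v (\<lambda>q w. \<not> P q w) (Dia k, q)"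
proof -
  let ?X = "children (fst t) v"
  let ?Y = "{w \<in> ?X. \<not> P q w}"
  have fin: "finite ?Y" using assms by simp
  have "hold_atom t v P (Box k, q) \<longleftrightarrow> card ?Y < k"
  proof
    assume "hold_atom t v P (Box k, q)"
    then obtain S where S: "finite S" "card S < k" "\<forall>w\<in>?X - S. P q w" by auto
    then have "?Y \<subseteq> S" by auto
    then show "card ?Y < k" using card_mono[OF S(1), of ?Y] S(2) by linarith
  next
    assume "card ?Y < k"
    then show "hold_atom t v P (Box k, q)" using fin by (auto intro!: exI[of _ ?Y])
  qed
  moreover have "hold_atom t v (\<lambda>q w. \<not> P q w) (Dia k, q) \<longleftrightarrow> k \<le> card ?Y"
  proof
    assume "hold_atom t v (\<lambda>q w. \<not> P q w) (Dia k, q)"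
    then obtain S where S: "S \<subseteq> ?X" "card S = k" "\<forall>w\<in>S. \<not> P q w" by auto
    then have "S \<subseteq> ?Y" by auto
    then show "k \<le> card ?Y" using card_mono[OF fin] S(2) by blast
  next
    assume "k \<le> card ?Y"
    then obtain S where "S \<subseteq> ?Y" "card S = k" "finite S" by (rule obtain_subset_with_card_n)
    then show "hold_atom t v (\<lambda>q w. \<not> P q w) (Dia k, q)" by (auto intro!: exI[of _ S])
  qed
  ultimately show ?thesis by linarith
qed

lemma state_definable_Dia:
  assumes "state_definable (\<lambda>t. Z t q)"
  shows "state_definable (\<lambda>t v. hold_atom t v (Z t) (Dia k, q))"
proof -
  obtain \<chi> where \<chi>: "\<And>t v. wf_tree t \<Longrightarrow> v \<in> fst t \<Longrightarrow> holds_s t v \<chi> = Z t q v"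
    using assms unfolding state_definable_def by blast
  have "holds_s t v (SD k \<chi>) = hold_atom t v (Z t) (Dia k, q)" if "wf_tree t" "v \<in> fst t" for t v
  proof -
    have "(\<forall>w\<in>S. holds_s t w \<chi>) = (\<forall>w\<in>S. Z t q w)" if "S \<subseteq> children (fst t) v" for S
      using that \<chi>[OF \<open>wf_tree t\<close>] by (auto simp: children_def)
    then show ?thesis unfolding holds_s.simps hold_atom.simps
      by (intro ex_cong1 conj_cong refl)
  qed
  then show ?thesis unfolding state_definable_def by blast
qed

lemma state_definable_atom:
  assumes "state_definable (\<lambda>t. Z t (snd a))"
  shows "state_definable (\<lambda>t v. hold_atom t v (Z t) a)"
proof -
  obtain m q where a: "a = (m, q)" by fastforce
  show ?thesis
  proof (cases m)
    case (Dia k)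
    then show ?thesis using state_definable_Dia[of Z q k] assms a by simp
  next
    case (Box k)
    have "state_definable (\<lambda>t v. \<not> hold_atom t v (\<lambda>q w. \<not> Z t q w) (Dia k, q))"
      using assms a by (intro state_definable_Not state_definable_Dia) simp
    then show ?thesis unfolding a Box
      by (rule state_definable_cong) (simp add: hold_atom_Box_iff wf_tree_def del: hold_atom.simps)
  qed
qed

lemma state_definable_pbf:
  "(\<And>a. a \<in> set_pbf b \<Longrightarrow> state_definable (\<lambda>t v. f t v a)) \<Longrightarrow> state_definable (\<lambda>t v. sat_pbf (f t v) b)"
  by (induction b)
    (auto intro: state_definable_True state_definable_Not[OF state_definable_True, simplified]
      state_definable_And state_definable_Or)

section \<open>Path formulae as a lattice closed under next and until\<close>

definition path_definable :: "('ap tree \<times> (nat \<Rightarrow> nat list) \<times> nat) set set" where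
  "path_definable = {X. \<exists>\<psi>. \<forall>t \<pi> i. wf_tree t \<longrightarrow> is_tpath t \<pi> \<longrightarrow> (t, \<pi>, i) \<in> X \<longleftrightarrow> holds_p t \<pi> i \<psi>}"

lemma path_definableI:
  "(\<And>t \<pi> i. wf_tree t \<Longrightarrow> is_tpath t \<pi> \<Longrightarrow> (t, \<pi>, i) \<in> X \<longleftrightarrow> holds_p t \<pi> i \<psi>) \<Longrightarrow> X \<in> path_definable"
  unfolding path_definable_def by blast

lemma path_definableE:
  assumes "X \<in> path_definable"
  obtains \<psi> where "\<And>t \<pi> i. wf_tree t \<Longrightarrow> is_tpath t \<pi> \<Longrightarrow> (t, \<pi>, i) \<in> X \<longleftrightarrow> holds_p t \<pi> i \<psi>"
  using assms unfolding path_definable_def by blast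

lemma path_definable_cong:
  assumes "X \<in> path_definable"
    "\<And>t \<pi> i. wf_tree t \<Longrightarrow> is_tpath t \<pi> \<Longrightarrow> (t, \<pi>, i) \<in> X' \<longleftrightarrow> (t, \<pi>, i) \<in> X"
  shows "X' \<in> path_definable"
  using assms unfolding path_definable_def by simp

lemma tpath_mem: "wf_tree t \<Longrightarrow> is_tpath t \<pi> \<Longrightarrow> \<pi> i \<in> fst t"
  by (cases i) (auto simp: is_tpath_def wf_tree_def children_def)

lemma path_definable_state:
  assumes "state_definable P"
  shows "{(t, \<pi>, i). P t (\<pi> i)} \<in> path_definable"
proof -
  obtain \<chi> where "\<And>t v. wf_tree t \<Longrightarrow> v \<in> fst t \<Longrightarrow> holds_s t v \<chi> = P t v"
    using assms unfolding state_definable_def by blast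
  then show ?thesis by (intro path_definableI[of _ "PSt \<chi>"]) (simp add: tpath_mem)
qed

lemma path_definable_next:
  assumes "X \<in> path_definable"
  shows "{(t, \<pi>, i). (t, \<pi>, Suc i) \<in> X} \<in> path_definable"
proof -
  obtain \<psi> where "\<And>t \<pi> i. wf_tree t \<Longrightarrow> is_tpath t \<pi> \<Longrightarrow> (t, \<pi>, i) \<in> X \<longleftrightarrow> holds_p t \<pi> i \<psi>"
    using path_definableE[OF assms] by blast
  then show ?thesis by (intro path_definableI[of _ "PX \<psi>"]) simp
qed

lemma path_definable_until:
  assumes "X \<in> path_definable" "Y \<in> path_definable"
  shows "{(t, \<pi>, i). \<exists>k\<ge>i. (t, \<pi>, k) \<in> Y \<and> (\<forall>j. i \<le> j \<and> j < k \<longrightarrow> (t, \<pi>, j) \<in> X)} \<in> path_definable"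
proof -
  obtain \<psi> where "\<And>t \<pi> i. wf_tree t \<Longrightarrow> is_tpath t \<pi> \<Longrightarrow> (t, \<pi>, i) \<in> X \<longleftrightarrow> holds_p t \<pi> i \<psi>"
    using path_definableE[OF assms(1)] by blast
  moreover obtain \<psi>' where "\<And>t \<pi> i. wf_tree t \<Longrightarrow> is_tpath t \<pi> \<Longrightarrow> (t, \<pi>, i) \<in> Y \<longleftrightarrow> holds_p t \<pi> i \<psi>'"
    using path_definableE[OF assms(2)] by blast
  ultimately show ?thesis by (intro path_definableI[of _ "PU \<psi> \<psi>'"]) simp
qed

interpretation path_lattice: set_lattice path_definable
proof
  show "UNIV \<in> path_definable"
    using path_definable_state[OF state_definable_True] by (simp add: case_prod_unfold)
  show "{} \<in> path_definable"
    using path_definable_state[OF state_definable_Not[OF state_definable_True]]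
    by (simp add: case_prod_unfold)
  fix X Y :: "('a tree \<times> (nat \<Rightarrow> nat list) \<times> nat) set"
  assume "X \<in> path_definable" "Y \<in> path_definable"
  then obtain \<psi> \<psi>' where
    "\<And>t \<pi> i. wf_tree t \<Longrightarrow> is_tpath t \<pi> \<Longrightarrow> (t, \<pi>, i) \<in> X \<longleftrightarrow> holds_p t \<pi> i \<psi>"
    "\<And>t \<pi> i. wf_tree t \<Longrightarrow> is_tpath t \<pi> \<Longrightarrow> (t, \<pi>, i) \<in> Y \<longleftrightarrow> holds_p t \<pi> i \<psi>'"
    by (metis path_definableE)
  then show "X \<inter> Y \<in> path_definable" "X \<union> Y \<in> path_definable"
    by (auto intro: path_definableI[of _ "PAnd \<psi> \<psi>'"] path_definableI[of _ "POr \<psi> \<psi>'"])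
qed

section \<open>Reading the linearisation along a branch\<close>

locale counter_free_visible = hesitant_aut A comps
  for A :: "('ap::finite, 'q) hta" and comps :: "('q set \<times> ckind) list" +
  assumes cf: "counter_free A comps" and vis: "visible A comps"
begin

lemma finite_comp: "q \<in> states A \<Longrightarrow> finite (comp q)"
  using wf mem_comp finite_subset[of "comp q" "states A"] by (auto simp: hta_wf_def)

lemma finite_annots:
  assumes "q \<in> states A"
  shows "finite (annots A (comp q) k)" "C \<in> annots A (comp q) k \<Longrightarrow> finite C"
proof -
  let ?B = "\<Union>q'\<in>comp q. \<Union>\<sigma>. set_pbf (delta A q' \<sigma>)"
  have fin: "finite ?B" using finite_comp[OF assms] by (simp add: finite_set_pbf)
  have "C \<subseteq> set_pbf (delta A q' \<sigma>)" if "lin_trans A (comp q) k (Some q') (\<sigma>, C) p" for q' \<sigma> C p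
  proof -
    have "\<exists>c\<in>clauses k (delta A q' \<sigma>). C \<subseteq> c"
      using that unfolding lin_trans_Some by (cases p) auto
    then show ?thesis using clauses_subset by blast
  qed
  then have sub: "annots A (comp q) k \<subseteq> Pow ?B" unfolding annots_def by fastforce
  then show "finite (annots A (comp q) k)" by (rule finite_subset) (simp add: fin)
  show "finite C" if "C \<in> annots A (comp q) k" using sub that fin finite_subset by blast
qed

text \<open>The letter is the transition relation of the pair of label and annotation, so that the
  alphabet lies in the transition monoid. The conditions on \<open>t\<close> and
  \<open>\<pi>\<close> are built in because uniqueness of the annotation is known only for nodes of
  well-formed trees.\<close>

definition annot_step :: "'q \<Rightarrow> 'ap tree \<times> (nat \<Rightarrow> nat list) \<times> nat \<Rightarrow> 'q option rel \<Rightarrow>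
    'ap tree \<times> (nat \<Rightarrow> nat list) \<times> nat \<Rightarrow> bool" where
  "annot_step q0 = (\<lambda>(t, \<pi>, i) m y. wf_tree t \<and> is_tpath t \<pi> \<and> y = (t, \<pi>, Suc i) \<and>
     (\<exists>C\<in>annots A (comp q0) (knd q0). annot_ok (knd q0) (hold_atom t (\<pi> i) (sem A comps t)) C \<and>
        m = lin_rel A (comp q0) (knd q0) [(snd t (\<pi> i), C)]))"

abbreviation letters :: "'q \<Rightarrow> 'q option rel set" where
  "letters q0 \<equiv> (\<lambda>a. lin_rel A (comp q0) (knd q0) [a]) ` (UNIV \<times> annots A (comp q0) (knd q0))"

text \<open>Determinism is visibility. Letters are definable because the atoms of an annotation
  refer to lower components, for which \<open>lower\<close> provides state formulae.\<close>

lemma step_system_annot: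
  assumes q0: "q0 \<in> states A" "knd q0 \<noteq> Transient"
    and lower: "\<And>q. q \<in> states A \<Longrightarrow> idx q < idx q0 \<Longrightarrow> state_definable (\<lambda>t. sem A comps t q)"
  shows "step_system path_definable (letters q0) (annot_step q0)"
proof
  let ?An = "annots A (comp q0) (knd q0)" and ?rel = "lin_rel A (comp q0) (knd q0)"
  let ?ok = "\<lambda>t v C. annot_ok (knd q0) (hold_atom t v (sem A comps t)) C"
  define L where "L = (\<lambda>(\<sigma>, C). {(t :: 'ap tree, \<pi> :: nat \<Rightarrow> nat list, i :: nat). snd t (\<pi> i) = \<sigma> \<and> ?ok t (\<pi> i) C})"
  have L: "L a \<in> path_definable" if a: "a \<in> UNIV \<times> ?An" for a
  proof -
    obtain \<sigma> C where aeq: "a = (\<sigma>, C)" "C \<in> ?An" using a by auto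
    have "state_definable (\<lambda>t v. hold_atom t v (sem A comps t) b = (knd q0 = Existential))" if "b \<in> C" for b
    proof -
      have *: "state_definable (\<lambda>t v. hold_atom t v (sem A comps t) b)"
        using annots_states[OF q0(1) aeq(2) that] lower by (intro state_definable_atom) blast
      then show ?thesis using state_definable_Not[OF *] by (cases "knd q0 = Existential") simp_all
    qed
    then have "state_definable (\<lambda>t v. \<forall>b\<in>C. hold_atom t v (sem A comps t) b = (knd q0 = Existential))"
      using finite_annots(2)[OF q0(1) aeq(2)] by (rule state_definable_Ball[rotated])
    then have "state_definable (\<lambda>t v. snd t v = \<sigma> \<and> ?ok t v C)"
      unfolding annot_ok_def by (rule state_definable_And[OF state_definable_label])
    then show ?thesis using path_definable_state unfolding L_def aeq by fastforce
  qed
  have finL: "finite (UNIV \<times> ?An :: ('ap set \<times> 'q atom set) set)"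
    using finite_annots(1)[OF q0(1)] by simp
  have step: "annot_step q0 (t, \<pi>, i) m y \<longleftrightarrow> y = (t, \<pi>, Suc i) \<and>
      (\<exists>a\<in>UNIV \<times> ?An. (t, \<pi>, i) \<in> L a \<and> m = ?rel [a])" if "wf_tree t" "is_tpath t \<pi>" for t \<pi> i m y
    using that by (auto simp: annot_step_def L_def)
  show "a = b \<and> y = z" if s: "annot_step q0 x a y" "annot_step q0 x b z" for x a b y z
  proof -
    obtain t \<pi> i where x: "x = (t, \<pi>, i)" by (cases x)
    obtain C C' where C: "wf_tree t" "is_tpath t \<pi>" "C \<in> ?An" "?ok t (\<pi> i) C" "a = ?rel [(snd t (\<pi> i), C)]"
      "C' \<in> ?An" "?ok t (\<pi> i) C'" "b = ?rel [(snd t (\<pi> i), C')]" "y = z"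
      using s unfolding x annot_step_def by auto
    have "C = C'"
      using visible_annot_unique[OF vis C(1) tpath_mem[OF C(1,2)] q0 C(3,4,6,7)] .
    then show ?thesis using C by simp
  qed
  show "a \<in> letters q0" if "annot_step q0 x a y" for x a y
    using that by (cases x) (auto simp: annot_step_def)
  show "next_in (annot_step q0) m X \<in> path_definable" if X: "X \<in> path_definable" for m X
  proof (rule path_definable_cong)
    show "(\<Union>a\<in>{a \<in> UNIV \<times> ?An. m = ?rel [a]}. L a) \<inter> {(t, \<pi>, i). (t, \<pi>, Suc i) \<in> X} \<in> path_definable"
      using finL by (intro path_lattice.Int_mem path_lattice.UN_mem path_definable_next X L) auto
    fix t :: "'ap tree" and \<pi> :: "nat \<Rightarrow> nat list" and i :: nat
    assume "wf_tree t" "is_tpath t \<pi>"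
    then show "(t, \<pi>, i) \<in> next_in (annot_step q0) m X \<longleftrightarrow>
        (t, \<pi>, i) \<in> (\<Union>a\<in>{a \<in> UNIV \<times> ?An. m = ?rel [a]}. L a) \<inter> {(t, \<pi>, i). (t, \<pi>, Suc i) \<in> X}"
      by (cases t) (auto simp: next_in_def step)
  qed
  show "until (annot_step q0) X Y \<in> path_definable" if X: "X \<in> path_definable" and Y: "Y \<in> path_definable" for X Y
  proof (rule path_definable_cong)
    \<comment> \<open>\<open>?L\<close> says that some annotation holds, that is, that a step
      exists. An until over steps requires this at every position before the goal, while
      \<open>PU\<close> does not.\<close>
    let ?L = "\<Union>a\<in>UNIV \<times> ?An. L a"
    let ?U = "{(t, \<pi>, i). \<exists>k\<ge>i. (t, \<pi>, k) \<in> Y \<and> (\<forall>j. i \<le> j \<and> j < k \<longrightarrow> (t, \<pi>, j) \<in> X \<inter> ?L)}"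
    show "?U \<in> path_definable"
      using finL by (intro path_definable_until path_lattice.Int_mem path_lattice.UN_mem X Y L) auto
    fix t :: "'ap tree" and \<pi> :: "nat \<Rightarrow> nat list" and i :: nat
    assume t: "wf_tree t" "is_tpath t \<pi>"
    have fwd: "x = (t, \<pi>, i) \<Longrightarrow> x \<in> ?U" if "x \<in> until (annot_step q0) X Y" for x i
      using that
    proof (induction arbitrary: i)
      case (until_now x)
      then show ?case by auto
    next
      case (until_step x a y)
      then have y: "y = (t, \<pi>, Suc i)" "x \<in> ?L" using step[OF t] by auto
      then obtain k where k: "k \<ge> Suc i" "(t, \<pi>, k) \<in> Y"
        "\<forall>j. Suc i \<le> j \<and> j < k \<longrightarrow> (t, \<pi>, j) \<in> X \<inter> ?L" using until_step.IH by blast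
      have "(t, \<pi>, j) \<in> X \<inter> ?L" if "i \<le> j" "j < k" for j
        using that k(3) y until_step by (cases "j = i") auto
      then show ?case using k until_step.prems by (auto intro!: exI[of _ k])
    qed
    have bwd: "(t, \<pi>, i) \<in> until (annot_step q0) X Y"
      if "(t, \<pi>, i + d) \<in> Y" "\<forall>j. i \<le> j \<and> j < i + d \<longrightarrow> (t, \<pi>, j) \<in> X \<inter> ?L" for d i
      using that
    proof (induction d arbitrary: i)
      case 0
      then show ?case by (auto intro: until_now)
    next
      case (Suc d)
      have i: "(t, \<pi>, i) \<in> X" "(t, \<pi>, i) \<in> ?L" using Suc.prems(2) by auto
      then obtain m where "annot_step q0 (t, \<pi>, i) m (t, \<pi>, Suc i)" using step[OF t] by blast
      moreover have "(t, \<pi>, Suc i) \<in> until (annot_step q0) X Y" using Suc.prems by (intro Suc.IH) auto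
      ultimately show ?case using i(1) until_step by metis
    qed
    show "(t, \<pi>, i) \<in> until (annot_step q0) X Y \<longleftrightarrow> (t, \<pi>, i) \<in> ?U"
    proof
      assume "(t, \<pi>, i) \<in> ?U"
      then obtain k where "k \<ge> i" "(t, \<pi>, k) \<in> Y" "\<forall>j. i \<le> j \<and> j < k \<longrightarrow> (t, \<pi>, j) \<in> X \<inter> ?L"
        by blast
      then show "(t, \<pi>, i) \<in> until (annot_step q0) X Y" using bwd[of i "k - i"] by simp
    qed (rule fwd[OF _ refl])
  qed
qed

abbreviation annot_steps :: "'q \<Rightarrow> 'ap tree \<times> (nat \<Rightarrow> nat list) \<times> nat \<Rightarrow> 'q option rel \<Rightarrow>
    'ap tree \<times> (nat \<Rightarrow> nat list) \<times> nat \<Rightarrow> bool" where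
  "annot_steps q0 \<equiv> steps (O) (lin_rel A (comp q0) (knd q0) []) (annot_step q0)"

lemma steps_imp_exits:
  assumes "annot_steps q0 x m y" "x = (t, \<pi>, i)" "(Some q, None) \<in> m"
    and "q0 \<in> states A" "q \<in> states A" "idx q = idx q0"
  shows "\<exists>n. exits t n q (\<pi> i)"
  using assms
proof (induction arbitrary: i q rule: steps.induct)
  case (steps_refl x)
  then show ?case by (auto simp: lin_rel_Nil)
next
  case (steps_step x a y m z)
  obtain C where C: "wf_tree t" "is_tpath t \<pi>" "y = (t, \<pi>, Suc i)"
    "annot_ok (knd q0) (hold_atom t (\<pi> i) (sem A comps t)) C"
    "a = lin_rel A (comp q0) (knd q0) [(snd t (\<pi> i), C)]"
    using steps_step.hyps(1) steps_step.prems(1) by (auto simp: annot_step_def)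
  obtain p where p: "(Some q, p) \<in> a" "(p, None) \<in> m" using steps_step.prems(2) by auto
  have l: "lin_trans A (comp q) (knd q) (Some q) (snd t (\<pi> i), C) p"
    using p(1) C(5) steps_step.prems(5) by (simp add: lin_rel_single)
  have "\<exists>n. case p of None \<Rightarrow> True | Some q' \<Rightarrow> \<exists>w\<in>children (fst t) (\<pi> i). exits t n q' w"
  proof (cases p)
    case (Some q')
    then have "q' \<in> states A" "idx q' = idx q" using lin_trans_target[OF steps_step.prems(4)] l by blast+
    then obtain n where "exits t n q' (\<pi> (Suc i))"
      using steps_step.IH[OF C(3), of q'] p(2) Some steps_step.prems by auto
    then show ?thesis using Some C(2) by (auto simp: is_tpath_def)
  qed simp
  then obtain n where "exits t (Suc n) q (\<pi> i)"
    unfolding exits_Suc[OF steps_step.prems(4)] using l C(4)[folded steps_step.prems(5)] by blast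
  then show ?case by blast
qed

lemma infinite_path_exists:
  assumes "wf_tree t" "v \<in> fst t"
  obtains \<rho> where "\<rho> 0 = v" "\<And>j. \<rho> (Suc j) \<in> children (fst t) (\<rho> j)"
proof -
  define \<rho> where "\<rho> = rec_nat v (\<lambda>_ u. SOME w. w \<in> children (fst t) u)"
  have step: "u \<in> fst t \<Longrightarrow> (SOME w. w \<in> children (fst t) u) \<in> children (fst t) u" for u
    using assms(1) some_in_eq[of "children (fst t) u"] by (simp add: wf_tree_def)
  have "\<rho> j \<in> fst t" for j
  proof (induction j)
    case (Suc j)
    then show ?case using step[OF Suc] by (simp add: \<rho>_def children_def)
  qed (simp add: \<rho>_def assms)
  then have "\<rho> (Suc j) \<in> children (fst t) (\<rho> j)" for j using step[of "\<rho> j"] by (simp add: \<rho>_def)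
  then show thesis using that[of \<rho>] by (simp add: \<rho>_def)
qed

text \<open>The branch \<open>\<rho>\<close> grows from \<open>v\<close> downwards, while steps are
  taken on paths from the root. Quantifying over all \<open>\<pi>\<close> that continue as
  \<open>\<rho>\<close> leaves the part above \<open>v\<close> open, which lets the induction put a
  node in front.\<close>

lemma exits_imp_steps:
  assumes "wf_tree t" "v \<in> fst t" "exits t n q v" "q0 \<in> states A" "q \<in> states A" "idx q = idx q0"
  shows "\<exists>\<rho>. \<rho> 0 = v \<and> (\<forall>j. \<rho> (Suc j) \<in> children (fst t) (\<rho> j)) \<and>
    (\<forall>\<pi> i. is_tpath t \<pi> \<longrightarrow> (\<forall>j. \<pi> (i + j) = \<rho> j) \<longrightarrow>
       (\<exists>m y. annot_steps q0 (t, \<pi>, i) m y \<and> (Some q, None) \<in> m))"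
  using assms
proof (induction n arbitrary: q v)
  case (Suc n)
  note q = \<open>q \<in> states A\<close>
  let ?rel = "lin_rel A (comp q0) (knd q0)"
  obtain C p where C: "lin_trans A (comp q) (knd q) (Some q) (snd t v, C) p"
    "annot_ok (knd q) (hold_atom t v (sem A comps t)) C"
    "case p of None \<Rightarrow> True | Some q' \<Rightarrow> \<exists>w\<in>children (fst t) v. exits t n q' w"
    using Suc.prems(3) unfolding exits_Suc[OF q] by blast
  have an: "C \<in> annots A (comp q0) (knd q0)"
  proof -
    have "q \<in> comp q0" using C(1) Suc.prems(6) by (simp add: lin_trans_Some)
    then show ?thesis using C(1)[unfolded Suc.prems(6)] unfolding annots_def by blast
  qed
  have step: "annot_step q0 (t, \<pi>, i) (?rel [(snd t v, C)]) (t, \<pi>, Suc i)" if "is_tpath t \<pi>" "\<pi> i = v" for \<pi> i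
    using that an C(2) Suc.prems(1,6) by (auto simp: annot_step_def)
  have qp: "(Some q, p) \<in> ?rel [(snd t v, C)]" using C(1) Suc.prems(6) by (simp add: lin_rel_single)
  show ?case
  proof (cases p)
    case None
    \<comment> \<open>After the exit the branch may go on arbitrarily, but it must be infinite; this
      is where leaflessness is used.\<close>
    obtain \<rho> where \<rho>: "\<rho> 0 = v" "\<And>j. \<rho> (Suc j) \<in> children (fst t) (\<rho> j)"
      using infinite_path_exists[OF Suc.prems(1,2)] by blast
    have "\<exists>m y. annot_steps q0 (t, \<pi>, i) m y \<and> (Some q, None) \<in> m"
      if "is_tpath t \<pi>" "\<forall>j. \<pi> (i + j) = \<rho> j" for \<pi> i
    proof -
      have "\<pi> i = v" using that(2) \<rho>(1) by (metis add.right_neutral)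
      then have "annot_steps q0 (t, \<pi>, i) (?rel [(snd t v, C)] O ?rel []) (t, \<pi>, Suc i)"
        using step[OF that(1)] by (blast intro: steps.intros)
      moreover have "(Some q, None) \<in> ?rel [(snd t v, C)] O ?rel []"
        using qp None by (auto simp: lin_rel_Nil)
      ultimately show ?thesis by blast
    qed
    then show ?thesis using \<rho> by blast
  next
    case (Some q')
    then obtain w where w: "w \<in> children (fst t) v" "exits t n q' w" using C(3) by auto
    have q': "q' \<in> states A" "idx q' = idx q0"
      using lin_trans_target[OF q C(1)[unfolded Some]] Suc.prems(6) by simp_all
    have "w \<in> fst t" using w(1) by (simp add: children_def)
    from Suc.IH[OF Suc.prems(1) this w(2) Suc.prems(4) q']
    obtain \<rho> where \<rho>: "\<rho> 0 = w" "\<forall>j. \<rho> (Suc j) \<in> children (fst t) (\<rho> j)"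
      "\<And>\<pi> i. is_tpath t \<pi> \<Longrightarrow> (\<forall>j. \<pi> (i + j) = \<rho> j) \<Longrightarrow>
        \<exists>m y. annot_steps q0 (t, \<pi>, i) m y \<and> (Some q', None) \<in> m" by blast
    let ?\<rho> = "case_nat v \<rho>"
    have "\<exists>m y. annot_steps q0 (t, \<pi>, i) m y \<and> (Some q, None) \<in> m"
      if tp: "is_tpath t \<pi>" "\<forall>j. \<pi> (i + j) = ?\<rho> j" for \<pi> i
    proof -
      have i: "\<pi> i = v" using tp(2)[rule_format, of 0] by simp
      have "\<forall>j. \<pi> (Suc i + j) = \<rho> j" using tp(2)[rule_format, of "Suc _"] by simp
      then obtain m y where m: "annot_steps q0 (t, \<pi>, Suc i) m y" "(Some q', None) \<in> m"
        using \<rho>(3)[OF tp(1)] by blast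
      have "annot_steps q0 (t, \<pi>, i) (?rel [(snd t v, C)] O m) y"
        using steps_step[of "annot_step q0", OF step[OF tp(1) i] m(1)] .
      moreover have "(Some q, None) \<in> ?rel [(snd t v, C)] O m" using qp m(2) Some by auto
      ultimately show ?thesis by blast
    qed
    moreover have "?\<rho> (Suc j) \<in> children (fst t) (?\<rho> j)" for j
      using \<rho>(1,2) w(1) by (cases j) simp_all
    ultimately show ?thesis by (intro exI[of _ ?\<rho>]) simp
  qed
qed simp

text \<open>The formula is \<open>SE\<close> of: some prefix from here has one of the finitely many
  values \<open>m\<close> that relate \<open>q\<close> to the exit state. Where the prefix ends is
  immaterial, hence the target \<open>UNIV\<close>.\<close>

lemma state_definable_exits:
  assumes q: "q \<in> states A" "knd q \<noteq> Transient"
    and lower: "\<And>q'. q' \<in> states A \<Longrightarrow> idx q' < idx q \<Longrightarrow> state_definable (\<lambda>t. sem A comps t q')"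
  shows "state_definable (\<lambda>t v. \<exists>n. exits t n q v)"
proof -
  let ?rel = "lin_rel A (comp q) (knd q)" and ?L = "UNIV \<times> annots A (comp q) (knd q)"
  let ?M = "?rel ` lists ?L"
  have "counter_free_lin A (comp q) (knd q)"
    using cf q idx_states[OF q(1)] unfolding counter_free_def by (metis (mono_tags, lifting) case_prodD nth_mem prod.collapse)
  then interpret aperiodic_monoid ?M "(O)" "?rel []"
    by (rule aperiodic_monoid_lin_rel[OF finite_comp[OF q(1)]])
  interpret step_system path_definable "letters q" "annot_step q"
    using step_system_annot[OF q lower] .
  have sub: "letters q \<subseteq> ?M" by auto
  let ?E = "\<Union>m\<in>{m \<in> ?M. (Some q, None) \<in> m}. {x. \<exists>y\<in>UNIV. annot_steps q x m y}"
  have "?E \<in> path_definable"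
    using finite_carrier
    by (intro path_lattice.UN_mem
        steps_definable[OF aperiodic_monoid_axioms step_system_axioms sub path_lattice.UNIV_mem]) simp
  then obtain \<psi> where \<psi>: "\<And>t \<pi> i. wf_tree t \<Longrightarrow> is_tpath t \<pi> \<Longrightarrow> (t, \<pi>, i) \<in> ?E \<longleftrightarrow> holds_p t \<pi> i \<psi>"
    using path_definableE by blast
  have E: "x \<in> ?E \<longleftrightarrow> (\<exists>m y. annot_steps q x m y \<and> (Some q, None) \<in> m)" for x
  proof -
    have letM: "\<forall>x a y. annot_step q x a y \<longrightarrow> a \<in> ?M"
      using letter sub by (meson subsetD)
    have "x \<in> (\<Union>m\<in>{m \<in> S. Q m}. {x. \<exists>y\<in>UNIV. T x m y}) \<longleftrightarrow> (\<exists>m y. T x m y \<and> Q m)"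
      if "\<And>m y. T x m y \<Longrightarrow> m \<in> S" for x and S :: "'q option rel set" and Q and T :: "_ \<Rightarrow> _ \<Rightarrow> 'x \<Rightarrow> bool"
      using that by blast
    then show ?thesis using steps_closed[OF _ letM] .
  qed
  have "holds_s t v (SE \<psi>) \<longleftrightarrow> (\<exists>n. exits t n q v)" if t: "wf_tree t" "v \<in> fst t" for t v
  proof
    assume "holds_s t v (SE \<psi>)"
    then obtain \<pi> i where \<pi>: "is_tpath t \<pi>" "\<pi> i = v" "holds_p t \<pi> i \<psi>" by auto
    then have "(t, \<pi>, i) \<in> ?E" using \<psi>[OF t(1)] by blast
    then obtain m y where "annot_steps q (t, \<pi>, i) m y" "(Some q, None) \<in> m" unfolding E by blast
    then show "\<exists>n. exits t n q v" using steps_imp_exits[OF _ refl _ q(1) q(1) refl] \<pi>(2) by blast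
  next
    assume "\<exists>n. exits t n q v"
    then obtain n where "exits t n q v" ..
    from exits_imp_steps[OF t this q(1) q(1) refl]
    obtain \<rho> where \<rho>: "\<rho> 0 = v" "\<And>j. \<rho> (Suc j) \<in> children (fst t) (\<rho> j)"
      "\<And>\<pi> i. is_tpath t \<pi> \<Longrightarrow> (\<forall>j. \<pi> (i + j) = \<rho> j) \<Longrightarrow>
        \<exists>m y. annot_steps q (t, \<pi>, i) m y \<and> (Some q, None) \<in> m" by blast
    have D: "prefix_closed (fst t)" "\<rho> 0 \<in> fst t" using t \<rho>(1) by (auto simp: wf_tree_def)
    obtain \<pi> where \<pi>: "\<pi> 0 = []" "\<And>i. \<pi> (Suc i) \<in> children (fst t) (\<pi> i)"
      "\<And>j. \<pi> (length (\<rho> 0) + j) = \<rho> j"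
      using path_extend[OF D \<rho>(2)] by blast
    have tp: "is_tpath t \<pi>" using \<pi> by (simp add: is_tpath_def)
    have "(t, \<pi>, length v) \<in> ?E" unfolding E using \<rho>(3)[OF tp] \<pi>(3) \<rho>(1) by blast
    then have "holds_p t \<pi> (length v) \<psi>" using \<psi>[OF t(1) tp] by blast
    moreover have "\<pi> (length v) = v" using \<pi>(3)[of 0] \<rho>(1) by simp
    ultimately show "holds_s t v (SE \<psi>)" using tp by auto
  qed
  then show ?thesis unfolding state_definable_def by blast
qed

text \<open>A universal component only needs the negation of the formula for exits, taken at the
  level of states, where negation is available.\<close>

lemma state_definable_sem:
  assumes "q \<in> states A"
  shows "state_definable (\<lambda>t. sem A comps t q)"
  using assms
proof (induction "idx q" arbitrary: q rule: less_induct)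
  case (less q)
  note q = \<open>q \<in> states A\<close>
  show ?case
  proof (cases "knd q = Transient")
    case True
    have "state_definable (\<lambda>t v. sat_pbf (hold_atom t v (sem A comps t)) (delta A q \<sigma>))" for \<sigma>
      using less.hyps delta_states[OF q] transient_less[OF q True]
      by (intro state_definable_pbf state_definable_atom) blast
    then have "state_definable (\<lambda>t v. \<exists>\<sigma>\<in>UNIV. snd t v = \<sigma> \<and>
        sat_pbf (hold_atom t v (sem A comps t)) (delta A q \<sigma>))"
      by (intro state_definable_Bex state_definable_And state_definable_label) simp_all
    then show ?thesis by (rule state_definable_cong) (simp add: sem_transient[OF q True])
  next
    case False
    have "state_definable (\<lambda>t v. \<exists>n. exits t n q v)"
      using state_definable_exits[OF q False] less.hyps by blast
    from this state_definable_Not[OF this]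
    have "state_definable (\<lambda>t v. knd q = Existential \<longleftrightarrow> (\<exists>n. exits t n q v))"
      by (cases "knd q = Existential") simp_all
    then show ?thesis by (rule state_definable_cong) (simp add: sem_nontransient[OF q False])
  qed
qed

end

theorem theorem7p4:
  fixes A :: "('ap::finite, 'q) hta" and comps :: "('q set \<times> ckind) list"
  assumes "hta_wf A"
    and "hesitant A comps"
    and "polarised A comps"
    and "counter_free A comps"
    and "visible A comps"
  shows "\<exists>\<phi> :: 'ap sform. hta_lang A = ctl_lang \<phi>"
proof -
  interpret counter_free_visible A comps using assms by unfold_locales
  have "init A \<in> states A" using wf by (simp add: hta_wf_def)
  then obtain \<phi> where "\<And>t v. wf_tree t \<Longrightarrow> v \<in> fst t \<Longrightarrow> holds_s t v \<phi> = sem A comps t (init A) v"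
    using state_definable_sem unfolding state_definable_def by blast
  then have "hta_lang A = ctl_lang \<phi>"
    by (auto simp: ctl_lang_def hta_lang_iff wf_tree_def)
  then show ?thesis ..
qed

end
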